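(* Let $f,\theta,g$ be free holomorphic functions on $[B(\mathcal H)^n]_1$ with scalar coefficients such that: (i) $f(X)=\theta(X)g(X)$, $X\in[B(\mathcal H)^n]_1$; (ii) $f$ is bounded with $\|f\|_\infty\le1$; (iii) $\theta$ has the radial infimum property and $\|\theta\|_\infty=1$. Then $\|g\|_\infty\le1$ and, consequently, $$f(X)f(X)^*\le\theta(X)\theta(X)^*,\qquad \|f(X)\|\le\|\theta(X)\|,\qquad X\in[B(\mathcal H)^n]_1,$$ and $\|g(0)\|\le1$. Moreover: (a) For $X_0\in[B(\mathcal H)^n]_1$, $f(X_0)f(X_0)^*<\theta(X_0)\theta(X_0)^*$ if and only if $\theta(X_0)\theta(X_0)^*>0$ and $g$ is not a constant $c$ with $|c|=1$. (b) For $X_0\in[B(\mathcal H)^n]_1$, $\|f(X_0)\|=\|\theta(X_0)\|$ if and only if either $\theta(X_0)=0$ or $f=c\theta$ for some constant $c$ with $|c|=1$. (c) If $|g(0)|=1$, then $f=c\theta$ for some constant $c$ with $|c|=1$.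
   Context: $\mathcal H$ is a separable infinite dimensional Hilbert space and $n\in\{1,2,\dots\}\cup\{\infty\}$. For $X=(X_1,\dots,X_n)\in B(\mathcal H)^n$, $\|X\|=\|\sum_iX_iX_i^*\|^{1/2}$, and $[B(\mathcal H)^n]_1=\{X:\|X\|<1\}$. $\mathbb F_n^+$ is the unital free semigroup on $g_1,\dots,g_n$; for $\alpha=g_{i_1}\cdots g_{i_k}$ put $|\alpha|=k$, $X_\alpha=X_{i_1}\cdots X_{i_k}$ ($X_\alpha=I$ for the neutral element, of length $0$). A free holomorphic function on $[B(\mathcal H)^n]_1$ with scalar coefficients is a map $f:[B(\mathcal H)^n]_1\to B(\mathcal H)$, $f(X)=\sum_{k=0}^\infty\sum_{|\alpha|=k}a_\alpha X_\alpha$ with $a_\alpha\in\mathbb C$, the series in $k$ converging in operator norm for all $X\in[B(\mathcal H)^n]_1$. The same series evaluates $f$ at strict row contractions on any Hilbert space. $\|f\|_\infty=\sup_{\|X\|<1}\|f(X)\|$; $f$ is bounded if this is finite. Scalars $c$ are identified with $cI$; $g(0)$ is identified with the constant coefficient of $g$. $S_i\varphi=e_i\otimes\varphi$ ($i=1,\dots,n$) are the left creation operators on the full Fock space $F^2(H_n)=\mathbb C1\oplus\bigoplus_{k\ge1}H_n^{\otimes k}$, where $H_n$ is an $n$-dimensional Hilbert space with orthonormal basis $e_1,\dots,e_n$. A bounded $\theta$ has the radial infimum property if $\liminf_{r\to1}\inf_{\|x\|=1}\|\theta(rS_1,\dots,rS_n)x\|=\|\theta\|_\infty$ (infimum over unit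 vectors $x\in F^2(H_n)$). For selfadjoint operators, $A<B$ means that $B-A$ is positive and invertible. *)

theory Defs
  imports "HOL-Analysis.Analysis"
begin

section \<open>Complex Hilbert spaces\<close>

text \<open>
  A complex Hilbert space is a complete space with a complex scalar multiplication and a
  complex inner product (linear in the first argument). Its real part is the real inner product
  of the underlying class, so norm and topology are those of
  \<^term>\<open>sqrt (Re (cinner x x))\<close>, and the type \<^typ>\<open>'a \<Rightarrow>\<^sub>L 'a\<close> of bounded
  real-linear maps, with the operator norm, is available.
\<close>

class chilbert_space = real_inner + complete_space +
  fixes scaleC :: "complex \<Rightarrow> 'a \<Rightarrow> 'a"  (infixr "*\<^sub>C" 75)
    and cinner :: "'a \<Rightarrow> 'a \<Rightarrow> complex"
  assumes scaleC_add_right: "c *\<^sub>C (x + y) = c *\<^sub>C x + c *\<^sub>C y"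
    and scaleC_add_left: "(c + d) *\<^sub>C x = c *\<^sub>C x + d *\<^sub>C x"
    and scaleC_scaleC: "c *\<^sub>C d *\<^sub>C x = (c * d) *\<^sub>C x"
    and scaleC_of_real: "complex_of_real r *\<^sub>C x = r *\<^sub>R x"
    and cinner_commute: "cinner x y = cnj (cinner y x)"
    and cinner_add_left: "cinner (x + y) z = cinner x z + cinner y z"
    and cinner_scaleC_left: "cinner (c *\<^sub>C x) y = c * cinner x y"
    and Re_cinner: "Re (cinner x y) = inner x y"
begin

subclass banach ..

end

global_interpretation complex_vector: vector_space "scaleC :: complex \<Rightarrow> 'a \<Rightarrow> 'a::chilbert_space"
proof
  show "1 *\<^sub>C x = x" for x :: 'a
    using scaleC_of_real[of 1 x] by simp
qed (simp_all add: scaleC_add_right scaleC_add_left scaleC_scaleC)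

lemma cinner_self: "cinner x x = complex_of_real ((norm x)\<^sup>2)"
proof -
  have "Im (cinner x x) = 0"
    using arg_cong[OF cinner_commute[of x x], of Im] by simp
  then show ?thesis
    by (simp add: complex_eq_iff Re_cinner power2_norm_eq_inner)
qed

lemma norm_scaleC: "norm (c *\<^sub>C x) = cmod c * norm (x::'a::chilbert_space)"
proof -
  have "cinner (c *\<^sub>C x) (c *\<^sub>C x) = c * cnj c * cinner x x"
    by (metis cinner_commute cinner_scaleC_left complex_cnj_mult mult.assoc mult.left_commute)
  then have "complex_of_real ((norm (c *\<^sub>C x))\<^sup>2) = complex_of_real ((cmod c * norm x)\<^sup>2)"
    by (simp add: cinner_self complex_norm_square[symmetric] power_mult_distrib)
  then have "(norm (c *\<^sub>C x))\<^sup>2 = (cmod c * norm x)\<^sup>2"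
    using of_real_eq_iff by blast
  then show ?thesis
    by (simp add: power2_eq_iff_nonneg)
qed

lemma bounded_linear_scaleC: "bounded_linear (scaleC c :: 'a::chilbert_space \<Rightarrow> 'a)"
proof (rule bounded_linear_intro[where K = "cmod c"])
  fix r :: real and x :: 'a
  show "c *\<^sub>C (r *\<^sub>R x) = r *\<^sub>R (c *\<^sub>C x)"
    by (simp add: scaleC_of_real[symmetric] scaleC_scaleC mult.commute)
qed (simp_all add: scaleC_add_right norm_scaleC mult.commute)


section \<open>Bounded operators\<close>

definition bounded_ops :: "('h::chilbert_space \<Rightarrow>\<^sub>L 'h) set" where
  "bounded_ops = {A :: 'h \<Rightarrow>\<^sub>L 'h. \<forall>c x. A (c *\<^sub>C x) = c *\<^sub>C A x}"

definition adj :: "('h::chilbert_space \<Rightarrow>\<^sub>L 'h) \<Rightarrow> ('h \<Rightarrow>\<^sub>L 'h)" where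
  "adj A = (THE B :: 'h \<Rightarrow>\<^sub>L 'h. \<forall>x y. cinner (A x) y = cinner x (B y))"

definition scalar_op :: "complex \<Rightarrow> ('h::chilbert_space \<Rightarrow>\<^sub>L 'h)" where
  "scalar_op c = Blinfun (scaleC c)"

lemma scalar_op_apply [simp]: "scalar_op c x = c *\<^sub>C x"
  by (simp add: scalar_op_def bounded_linear_Blinfun_apply bounded_linear_scaleC)

definition positive_op :: "('h::chilbert_space \<Rightarrow>\<^sub>L 'h) \<Rightarrow> bool" where
  "positive_op A \<longleftrightarrow> A \<in> bounded_ops \<and> (\<forall>x. cinner (A x) x \<in> \<real>\<^sub>\<ge>\<^sub>0)"

definition invertible_op :: "('h::chilbert_space \<Rightarrow>\<^sub>L 'h) \<Rightarrow> bool" where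
  "invertible_op A \<longleftrightarrow> (\<exists>B\<in>bounded_ops. A o\<^sub>L B = id_blinfun \<and> B o\<^sub>L A = id_blinfun)"

definition op_le :: "('h::chilbert_space \<Rightarrow>\<^sub>L 'h) \<Rightarrow> ('h \<Rightarrow>\<^sub>L 'h) \<Rightarrow> bool" where
  "op_le A B \<longleftrightarrow> positive_op (B - A)"

definition op_less :: "('h::chilbert_space \<Rightarrow>\<^sub>L 'h) \<Rightarrow> ('h \<Rightarrow>\<^sub>L 'h) \<Rightarrow> bool" where
  "op_less A B \<longleftrightarrow> positive_op (B - A) \<and> invertible_op (B - A)"


section \<open>The unit ball of row operators\<close>

text \<open>
  The number \<open>n\<close> of operators, finite or countably infinite, is the cardinality of the countable
  index type \<open>'n\<close>. If \<open>'n\<close> is infinite, \<open>\<Sum>i. X\<^sub>i X\<^sub>i*\<close> is a sum in the strong operator topology.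
\<close>

definition row_ops :: "('n::countable \<Rightarrow> 'h::chilbert_space \<Rightarrow>\<^sub>L 'h) set" where
  "row_ops = {X. (\<forall>i. X i \<in> bounded_ops) \<and>
     (\<exists>T :: 'h \<Rightarrow>\<^sub>L 'h. \<forall>h. ((\<lambda>i. X i (adj (X i) h)) has_sum T h) UNIV)}"

definition row_square :: "('n::countable \<Rightarrow> 'h::chilbert_space \<Rightarrow>\<^sub>L 'h) \<Rightarrow> ('h \<Rightarrow>\<^sub>L 'h)" where
  "row_square X = Blinfun (\<lambda>h. \<Sum>\<^sub>\<infinity>i. X i (adj (X i) h))"

lemma row_square_apply:
  fixes X :: "'n::countable \<Rightarrow> 'h::chilbert_space \<Rightarrow>\<^sub>L 'h"
  assumes "X \<in> row_ops"
  shows "((\<lambda>i. X i (adj (X i) h)) has_sum row_square X h) UNIV"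
proof -
  obtain T :: "'h \<Rightarrow>\<^sub>L 'h" where T: "\<And>h. ((\<lambda>i. X i (adj (X i) h)) has_sum T h) UNIV"
    using assms by (auto simp: row_ops_def)
  then have "(\<lambda>h. \<Sum>\<^sub>\<infinity>i. X i (adj (X i) h)) = blinfun_apply T"
    by (auto intro: infsumI)
  then show ?thesis
    using T by (simp add: row_square_def blinfun_apply_inverse)
qed

definition row_norm :: "('n::countable \<Rightarrow> 'h::chilbert_space \<Rightarrow>\<^sub>L 'h) \<Rightarrow> real" where
  "row_norm X = sqrt (norm (row_square X))"

definition row_ball :: "('n::countable \<Rightarrow> 'h::chilbert_space \<Rightarrow>\<^sub>L 'h) set" where
  "row_ball = {X \<in> row_ops. row_norm X < 1}"


section \<open>Free holomorphic functions\<close>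

text \<open>
  Elements of the free semigroup are words over \<open>'n\<close>, with length and neutral element \<open>[]\<close>.
\<close>

primrec word_op :: "('n \<Rightarrow> 'h::chilbert_space \<Rightarrow>\<^sub>L 'h) \<Rightarrow> 'n list \<Rightarrow> ('h \<Rightarrow>\<^sub>L 'h)" where
  "word_op X [] = id_blinfun"
| "word_op X (i # \<alpha>) = X i o\<^sub>L word_op X \<alpha>"

text \<open>
  For infinite \<open>'n\<close> a homogeneous part is an infinite sum; it is taken unconditionally in operator
  norm. On the whole ball this converges iff \<open>\<Sum>|a\<^sub>\<alpha>|\<^sup>2\<close> over words of each fixed length is finite.
\<close>

definition homogeneous_part ::
  "('n::countable list \<Rightarrow> complex) \<Rightarrow> ('n \<Rightarrow> 'h::chilbert_space \<Rightarrow>\<^sub>L 'h) \<Rightarrow> nat \<Rightarrow> ('h \<Rightarrow>\<^sub>L 'h)" where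
  "homogeneous_part a X k = (\<Sum>\<^sub>\<infinity>\<alpha>\<in>{\<alpha>. length \<alpha> = k}. scalar_op (a \<alpha>) o\<^sub>L word_op X \<alpha>)"

definition free_eval ::
  "('n::countable list \<Rightarrow> complex) \<Rightarrow> ('n \<Rightarrow> 'h::chilbert_space \<Rightarrow>\<^sub>L 'h) \<Rightarrow> ('h \<Rightarrow>\<^sub>L 'h)" where
  "free_eval a X = (\<Sum>k. homogeneous_part a X k)"

text \<open>
  \<open>f\<close> is the free holomorphic function on the ball with coefficients \<open>a\<close>. Values of \<open>f\<close> outside
  the ball are unconstrained.
\<close>

definition free_holomorphic ::
  "('n::countable list \<Rightarrow> complex) \<Rightarrow> (('n \<Rightarrow> 'h \<Rightarrow>\<^sub>L 'h) \<Rightarrow> ('h::chilbert_space \<Rightarrow>\<^sub>L 'h)) \<Rightarrow> bool" where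
  "free_holomorphic a f \<longleftrightarrow> (\<forall>X\<in>row_ball.
     (\<forall>k. (\<lambda>\<alpha>. scalar_op (a \<alpha>) o\<^sub>L word_op X \<alpha>) summable_on {\<alpha>. length \<alpha> = k}) \<and>
     (\<lambda>k. homogeneous_part a X k) sums f X)"

definition sup_norm :: "(('n::countable \<Rightarrow> 'h \<Rightarrow>\<^sub>L 'h) \<Rightarrow> ('h::chilbert_space \<Rightarrow>\<^sub>L 'h)) \<Rightarrow> ereal" where
  "sup_norm f = (SUP X\<in>row_ball. ereal (norm (f X)))"


section \<open>Square-summable families\<close>

typedef 'a ell2 = "{f :: 'a \<Rightarrow> complex. (\<lambda>i. (cmod (f i))\<^sup>2) summable_on UNIV}"
  morphisms coord Abs_ell2
  by (rule exI[of _ "\<lambda>_. 0"]) simp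

lemma coord_summable: "(\<lambda>i. (cmod (coord x i))\<^sup>2) summable_on UNIV"
  using coord[of x] by simp

lemma ell2_eqI: "(\<And>i. coord x i = coord y i) \<Longrightarrow> x = y"
  by (metis coord_inject ext)

lemma coord_Abs:
  assumes "(\<lambda>i. (cmod (f i))\<^sup>2) summable_on UNIV"
  shows "coord (Abs_ell2 f) = f"
  using assms by (simp add: Abs_ell2_inverse)

lemma sq_summable_add:
  fixes f g :: "'a \<Rightarrow> complex"
  assumes "(\<lambda>i. (cmod (f i))\<^sup>2) summable_on UNIV" "(\<lambda>i. (cmod (g i))\<^sup>2) summable_on UNIV"
  shows "(\<lambda>i. (cmod (f i + g i))\<^sup>2) summable_on UNIV"
proof (rule summable_on_comparison_test)
  show "(\<lambda>i. 2 * (cmod (f i))\<^sup>2 + 2 * (cmod (g i))\<^sup>2) summable_on UNIV"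
    by (intro summable_on_add summable_on_cmult_right assms)
  show "(cmod (f i + g i))\<^sup>2 \<le> 2 * (cmod (f i))\<^sup>2 + 2 * (cmod (g i))\<^sup>2" for i
  proof -
    have "(cmod (f i + g i))\<^sup>2 \<le> (cmod (f i) + cmod (g i))\<^sup>2"
      by (simp add: norm_triangle_ineq power_mono)
    also have "\<dots> \<le> 2 * (cmod (f i))\<^sup>2 + 2 * (cmod (g i))\<^sup>2"
      using zero_le_power2[of "cmod (f i) - cmod (g i)"]
      by (simp add: power2_eq_square algebra_simps)
    finally show ?thesis .
  qed
qed simp

lemma sq_summable_scale:
  fixes f :: "'a \<Rightarrow> complex"
  assumes "(\<lambda>i. (cmod (f i))\<^sup>2) summable_on UNIV"
  shows "(\<lambda>i. (cmod (c * f i))\<^sup>2) summable_on UNIV"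
  using summable_on_cmult_right[OF assms, of "(cmod c)\<^sup>2"]
  by (simp add: norm_mult power_mult_distrib)

lemma ell2_prod_summable: "(\<lambda>i. coord x i * cnj (coord y i)) summable_on UNIV"
proof (rule Infinite_Sum.abs_summable_summable, rule Infinite_Sum.abs_summable_on_comparison_test')
  show "(\<lambda>i. (cmod (coord x i))\<^sup>2 + (cmod (coord y i))\<^sup>2) summable_on UNIV"
    by (intro summable_on_add coord_summable)
  show "norm (coord x i * cnj (coord y i)) \<le> (cmod (coord x i))\<^sup>2 + (cmod (coord y i))\<^sup>2" for i
  proof -
    have "2 * (cmod (coord x i) * cmod (coord y i)) \<le> (cmod (coord x i))\<^sup>2 + (cmod (coord y i))\<^sup>2"
      using zero_le_power2[of "cmod (coord x i) - cmod (coord y i)"]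
      by (simp add: power2_eq_square algebra_simps)
    moreover have "0 \<le> cmod (coord x i) * cmod (coord y i)" by simp
    ultimately show ?thesis
      unfolding norm_mult complex_mod_cnj by linarith
  qed
qed

instantiation ell2 :: (type) real_vector
begin

definition "0 = Abs_ell2 (\<lambda>_. 0)"
definition "x + y = Abs_ell2 (\<lambda>i. coord x i + coord y i)"
definition "- x = Abs_ell2 (\<lambda>i. - coord x i)"
definition "x - y = Abs_ell2 (\<lambda>i. coord x i - coord y i)"
definition "r *\<^sub>R x = Abs_ell2 (\<lambda>i. complex_of_real r * coord x i)"
lemma coord_zero [simp]: "coord 0 i = 0"
  by (simp add: zero_ell2_def coord_Abs)

lemma coord_add [simp]: "coord (x + y) i = coord x i + coord y i"
  by (simp add: plus_ell2_def coord_Abs sq_summable_add coord_summable)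

lemma coord_uminus [simp]: "coord (- x) i = - coord x i"
  by (simp add: uminus_ell2_def coord_Abs coord_summable)

lemma coord_diff [simp]: "coord (x - y) i = coord x i - coord y i"
  using sq_summable_add[of "coord x" "\<lambda>i. - coord y i"]
  by (simp add: minus_ell2_def coord_Abs coord_summable)

lemma coord_scaleR [simp]: "coord (r *\<^sub>R x) i = complex_of_real r * coord x i"
  by (simp add: scaleR_ell2_def coord_Abs sq_summable_scale coord_summable)

instance
proof
  fix x y z :: "'a ell2" and r s :: real
  show "x + y + z = x + (y + z)" "x + y = y + x" "0 + x = x" "- x + x = 0" "x - y = x + - y"
    "r *\<^sub>R (x + y) = r *\<^sub>R x + r *\<^sub>R y" "(r + s) *\<^sub>R x = r *\<^sub>R x + s *\<^sub>R x"
    "r *\<^sub>R s *\<^sub>R x = (r * s) *\<^sub>R x" "1 *\<^sub>R x = x"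
    by (auto intro!: ell2_eqI simp: algebra_simps)
qed

end

instantiation ell2 :: (type) real_inner
begin

definition "norm x = sqrt (\<Sum>\<^sub>\<infinity>i. (cmod (coord x i))\<^sup>2)"
definition "dist x y = norm (x - y)" for x y :: "'a ell2"
definition "sgn x = x /\<^sub>R norm x" for x :: "'a ell2"
definition "(uniformity :: ('a ell2 \<times> 'a ell2) filter) = (INF e\<in>{0<..}. principal {(x, y). dist x y < e})"
definition "open U = (\<forall>x\<in>U. eventually (\<lambda>(x', y). x' = x \<longrightarrow> y \<in> U) uniformity)" for U :: "'a ell2 set"
definition "inner x y = Re (\<Sum>\<^sub>\<infinity>i. coord x i * cnj (coord y i))" for x y :: "'a ell2"

lemma ell2_inner_self: "inner x x = (\<Sum>\<^sub>\<infinity>i. (cmod (coord x i))\<^sup>2)" for x :: "'a ell2"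
proof -
  have "Re (\<Sum>\<^sub>\<infinity>i. coord x i * cnj (coord x i)) = (\<Sum>\<^sub>\<infinity>i. Re (coord x i * cnj (coord x i)))"
    by (rule infsum_Re[symmetric, OF ell2_prod_summable])
  then show ?thesis
    by (simp add: inner_ell2_def complex_mult_cnj cmod_power2)
qed

instance
proof
  fix x y z :: "'a ell2" and r :: real
  have "inner x y = Re (cnj (\<Sum>\<^sub>\<infinity>i. coord x i * cnj (coord y i)))"
    by (simp add: inner_ell2_def)
  also have "\<dots> = inner y x"
    unfolding inner_ell2_def infsum_cnj[symmetric] by (simp add: mult.commute)
  finally show "inner x y = inner y x" .
  show "inner (x + y) z = inner x z + inner y z"
    by (simp add: inner_ell2_def distrib_right infsum_add ell2_prod_summable)
  show "inner (r *\<^sub>R x) y = r * inner x y"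
    by (simp add: inner_ell2_def mult.assoc infsum_cmult_right')
  show "0 \<le> inner x x"
    by (simp add: ell2_inner_self infsum_nonneg)
  show "inner x x = 0 \<longleftrightarrow> x = 0"
  proof
    assume "inner x x = 0"
    then have "(cmod (coord x i))\<^sup>2 = 0" for i
      by (intro nonneg_infsum_le_0D[where A = UNIV and f = "\<lambda>i. (cmod (coord x i))\<^sup>2"])
        (simp_all add: ell2_inner_self coord_summable)
    then show "x = 0"
      by (auto intro: ell2_eqI)
  qed (simp add: ell2_inner_self)
  show "norm x = sqrt (inner x x)"
    by (simp add: norm_ell2_def ell2_inner_self)
qed (simp_all add: dist_ell2_def sgn_ell2_def uniformity_ell2_def open_ell2_def)

end

lemma ell2_norm_sq: "(norm x)\<^sup>2 = (\<Sum>\<^sub>\<infinity>i. (cmod (coord x i))\<^sup>2)"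
  by (simp add: norm_ell2_def infsum_nonneg)

lemma ell2_finite_sum_le: "finite F \<Longrightarrow> (\<Sum>i\<in>F. (cmod (coord x i))\<^sup>2) \<le> (norm x)\<^sup>2"
  unfolding ell2_norm_sq by (rule finite_sum_le_infsum) (simp_all add: coord_summable)

lemma coord_le_norm: "cmod (coord x i) \<le> norm x"
  using ell2_finite_sum_le[of "{i}" x] by (simp add: power2_le_iff_abs_le)

instance ell2 :: (type) complete_space
proof
  fix X :: "nat \<Rightarrow> 'a ell2"
  assume "Cauchy X"
  have "Cauchy (\<lambda>m. coord (X m) i)" for i
  proof (rule metric_CauchyI)
    fix e :: real assume "e > 0"
    then obtain M where M: "\<And>m n. m \<ge> M \<Longrightarrow> n \<ge> M \<Longrightarrow> dist (X m) (X n) < e"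
      using \<open>Cauchy X\<close> by (meson metric_CauchyD)
    have "dist (coord (X m) i) (coord (X n) i) < e" if "m \<ge> M" "n \<ge> M" for m n
      using M[OF that] coord_le_norm[of "X m - X n" i] by (simp add: dist_norm)
    then show "\<exists>M. \<forall>m\<ge>M. \<forall>n\<ge>M. dist (coord (X m) i) (coord (X n) i) < e"
      by blast
  qed
  then have "\<exists>l. (\<lambda>m. coord (X m) i) \<longlonglongrightarrow> l" for i
    using Cauchy_convergent convergent_def by blast
  then obtain L where L: "\<And>i. (\<lambda>m. coord (X m) i) \<longlonglongrightarrow> L i"
    by metis
  have tail: "\<exists>M. \<forall>m\<ge>M. \<forall>F. finite F \<longrightarrow> (\<Sum>i\<in>F. (cmod (coord (X m) i - L i))\<^sup>2) \<le> e\<^sup>2"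
    if "e > 0" for e :: real
  proof -
    obtain M where M: "\<And>m n. m \<ge> M \<Longrightarrow> n \<ge> M \<Longrightarrow> dist (X m) (X n) < e"
      using \<open>Cauchy X\<close> \<open>e > 0\<close> by (meson metric_CauchyD)
    have "(\<Sum>i\<in>F. (cmod (coord (X m) i - L i))\<^sup>2) \<le> e\<^sup>2" if "m \<ge> M" "finite F" for m F
    proof (rule LIMSEQ_le_const2)
      show "(\<lambda>n. \<Sum>i\<in>F. (cmod (coord (X m) i - coord (X n) i))\<^sup>2)
              \<longlonglongrightarrow> (\<Sum>i\<in>F. (cmod (coord (X m) i - L i))\<^sup>2)"
        by (intro tendsto_intros L)
      have "(\<Sum>i\<in>F. (cmod (coord (X m) i - coord (X n) i))\<^sup>2) \<le> e\<^sup>2" if "n \<ge> M" for n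
      proof -
        have "(\<Sum>i\<in>F. (cmod (coord (X m - X n) i))\<^sup>2) \<le> (norm (X m - X n))\<^sup>2"
          by (rule ell2_finite_sum_le[OF \<open>finite F\<close>])
        also have "\<dots> \<le> e\<^sup>2"
          using M[OF \<open>m \<ge> M\<close> that] by (intro power_mono) (simp_all add: dist_norm)
        finally show ?thesis by simp
      qed
      then show "\<exists>N. \<forall>n\<ge>N. (\<Sum>i\<in>F. (cmod (coord (X m) i - coord (X n) i))\<^sup>2) \<le> e\<^sup>2"
        by blast
    qed
    then show ?thesis by blast
  qed
  have diff: "(\<lambda>i. (cmod (coord (X m) i - L i))\<^sup>2) summable_on UNIV"
    if "\<forall>F. finite F \<longrightarrow> (\<Sum>i\<in>F. (cmod (coord (X m) i - L i))\<^sup>2) \<le> c" for m c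
    using that by (intro nonneg_bdd_above_summable_on) (auto intro!: bdd_aboveI[where M = c])
  obtain M where "\<forall>F. finite F \<longrightarrow> (\<Sum>i\<in>F. (cmod (coord (X M) i - L i))\<^sup>2) \<le> 1\<^sup>2"
    using tail[of 1] by auto
  then have "(\<lambda>i. (cmod (- 1 * (coord (X M) i - L i) + coord (X M) i))\<^sup>2) summable_on UNIV"
    by (intro sq_summable_add sq_summable_scale coord_summable diff)
  then have "(\<lambda>i. (cmod (L i))\<^sup>2) summable_on UNIV"
    by simp
  then have coord_L: "coord (Abs_ell2 L) = L"
    by (rule coord_Abs)
  have "X \<longlonglongrightarrow> Abs_ell2 L"
  proof (rule metric_LIMSEQ_I)
    fix r :: real assume "r > 0"
    then obtain M where M: "\<And>m F. m \<ge> M \<Longrightarrow> finite F \<Longrightarrow>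
        (\<Sum>i\<in>F. (cmod (coord (X m) i - L i))\<^sup>2) \<le> (r / 2)\<^sup>2"
      using tail[of "r / 2"] by auto
    have "dist (X m) (Abs_ell2 L) < r" if "m \<ge> M" for m
    proof -
      have "(norm (X m - Abs_ell2 L))\<^sup>2 \<le> (r / 2)\<^sup>2"
        unfolding ell2_norm_sq
        by (rule infsum_le_finite_sums[OF coord_summable]) (simp add: coord_L M[OF that])
      then have "norm (X m - Abs_ell2 L) \<le> r / 2"
        using \<open>r > 0\<close> by (simp add: power2_le_iff_abs_le)
      then show ?thesis
        using \<open>r > 0\<close> by (simp add: dist_norm)
    qed
    then show "\<exists>no. \<forall>n\<ge>no. dist (X n) (Abs_ell2 L) < r"
      by blast
  qed
  then show "convergent X"
    by (auto simp: convergent_def)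
qed

instantiation ell2 :: (type) chilbert_space
begin

definition "c *\<^sub>C x = Abs_ell2 (\<lambda>i. c * coord x i)"
definition "cinner x y = (\<Sum>\<^sub>\<infinity>i. coord x i * cnj (coord y i))"

lemma coord_scaleC [simp]: "coord (c *\<^sub>C x) i = c * coord x i"
  by (simp add: scaleC_ell2_def coord_Abs sq_summable_scale coord_summable)

instance
proof
  fix x y z :: "'a ell2" and c d :: complex and r :: real
  show "c *\<^sub>C (x + y) = c *\<^sub>C x + c *\<^sub>C y" "(c + d) *\<^sub>C x = c *\<^sub>C x + d *\<^sub>C x"
    "c *\<^sub>C d *\<^sub>C x = (c * d) *\<^sub>C x" "complex_of_real r *\<^sub>C x = r *\<^sub>R x"
    by (auto intro!: ell2_eqI simp: algebra_simps)
  show "cinner x y = cnj (cinner y x)"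
    unfolding cinner_ell2_def infsum_cnj[symmetric] by (simp add: mult.commute)
  show "cinner (x + y) z = cinner x z + cinner y z"
    by (simp add: cinner_ell2_def distrib_right infsum_add ell2_prod_summable)
  show "cinner (c *\<^sub>C x) y = c * cinner x y"
    by (simp add: cinner_ell2_def mult.assoc infsum_cmult_right')
  show "Re (cinner x y) = inner x y"
    by (simp add: cinner_ell2_def inner_ell2_def)
qed

end


section \<open>Full Fock space and the radial infimum property\<close>

text \<open>
  The vectors \<open>e\<^sub>\<alpha> = e\<^bsub>i\<^sub>1\<^esub> \<otimes> \<dots> \<otimes> e\<^bsub>i\<^sub>k\<^esub>\<close>, \<open>\<alpha> = i\<^sub>1\<dots>i\<^sub>k\<close> a word of length \<open>k\<close>, form an orthonormal basis of the
  \<open>k\<close>-fold tensor power (for \<open>k = 0\<close>, the vector \<open>1\<close>). Thus the full Fock space is the space of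
  square-summable families over words, an element \<open>\<phi>\<close> being given by its coordinates with respect
  to the \<open>e\<^sub>\<alpha>\<close>. Since \<open>e\<^sub>i \<otimes> e\<^sub>\<alpha> = e\<^bsub>i\<alpha>\<^esub>\<close>, the vector \<open>e\<^sub>i \<otimes> \<phi>\<close> has coordinate \<open>\<phi>\<^sub>\<alpha>\<close> at \<open>i\<alpha>\<close>, and \<open>0\<close>
  at words not starting with \<open>i\<close>.
\<close>

type_synonym 'n fock = "'n list ell2"

definition tensor_left :: "'n \<Rightarrow> 'n fock \<Rightarrow> 'n fock" where
  "tensor_left i \<phi> =
     Abs_ell2 (\<lambda>\<beta>. case \<beta> of [] \<Rightarrow> 0 | j # \<alpha> \<Rightarrow> if j = i then coord \<phi> \<alpha> else 0)"

definition creation :: "'n \<Rightarrow> ('n fock \<Rightarrow>\<^sub>L 'n fock)" where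
  "creation i = Blinfun (tensor_left i)"

lemma tensor_left_has_sum:
  "((\<lambda>\<beta>. (cmod (case \<beta> of [] \<Rightarrow> 0 | j # \<alpha> \<Rightarrow> if j = i then coord \<phi> \<alpha> else 0))\<^sup>2) has_sum (norm \<phi>)\<^sup>2) UNIV"
proof -
  have "((\<lambda>\<alpha>. (cmod (coord \<phi> \<alpha>))\<^sup>2) has_sum (norm \<phi>)\<^sup>2) UNIV"
    unfolding ell2_norm_sq by (rule has_sum_infsum[OF coord_summable])
  then have "((\<lambda>\<beta>. (cmod (case \<beta> of [] \<Rightarrow> 0 | j # \<alpha> \<Rightarrow> if j = i then coord \<phi> \<alpha> else 0))\<^sup>2)
      has_sum (norm \<phi>)\<^sup>2) (range ((#) i))"
    by (subst has_sum_reindex) (simp_all add: o_def)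
  then show ?thesis
    by (rule has_sum_cong_neutral[THEN iffD1, rotated -1]) (auto split: list.splits)
qed

lemma coord_tensor_left:
  "coord (tensor_left i \<phi>) \<beta> = (case \<beta> of [] \<Rightarrow> 0 | j # \<alpha> \<Rightarrow> if j = i then coord \<phi> \<alpha> else 0)"
  unfolding tensor_left_def
  by (subst coord_Abs[OF has_sum_imp_summable[OF tensor_left_has_sum]]) (rule refl)

lemma norm_tensor_left: "norm (tensor_left i \<phi>) = norm \<phi>"
proof -
  have "(norm (tensor_left i \<phi>))\<^sup>2 = (norm \<phi>)\<^sup>2"
    unfolding ell2_norm_sq[of "tensor_left i \<phi>"] coord_tensor_left
    by (rule infsumI[OF tensor_left_has_sum])
  then show ?thesis by simp
qed

lemma creation_apply: "creation i \<phi> = tensor_left i \<phi>"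
proof -
  have "bounded_linear (tensor_left i)"
  proof (rule bounded_linear_intro[where K = 1])
    show "tensor_left i (x + y) = tensor_left i x + tensor_left i y" for x y
      by (rule ell2_eqI) (simp add: coord_tensor_left split: list.splits)
    show "tensor_left i (r *\<^sub>R x) = r *\<^sub>R tensor_left i x" for r x
      by (rule ell2_eqI) (simp add: coord_tensor_left split: list.splits)
  qed (simp add: norm_tensor_left)
  then show ?thesis
    by (simp add: creation_def bounded_linear_Blinfun_apply)
qed

text \<open>
  Here \<open>a\<close> is the coefficient family of \<open>f\<close>: \<open>f\<close> itself is only defined on operators on \<open>'h\<close>, and its
  value at the strict row contraction \<open>(rS\<^sub>i)\<^sub>i\<close> on the Fock space is that of the same series.
\<close>

definition radial_infimum_property ::
  "('n::countable list \<Rightarrow> complex) \<Rightarrow> (('n \<Rightarrow> 'h \<Rightarrow>\<^sub>L 'h) \<Rightarrow> ('h::chilbert_space \<Rightarrow>\<^sub>L 'h)) \<Rightarrow> bool" where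
  "radial_infimum_property a f \<longleftrightarrow> sup_norm f < \<infinity> \<and>
     Liminf (at_left 1) (\<lambda>r. INF x\<in>{x :: 'n fock. norm x = 1}.
       ereal (norm (free_eval a (\<lambda>i. r *\<^sub>R creation i) x))) = sup_norm f"

end

theory Submission
  imports Defs
begin

text \<open>
  Write \<open>f(rS)\<close> for the value of the series of \<open>f\<close> at \<open>(rS\<^sub>i)\<^sub>i\<close>, \<open>S\<^sub>i\<close> the creation operators on the
  Fock space, \<open>0 \<le> r < 1\<close>.

  \<^emph>\<open>Why \<open>\<parallel>g\<parallel>\<^sub>\<infinity> \<le> 1\<close>.\<close> An infinite dimensional space contains a copy of the Fock space, and transporting
  \<open>(rS\<^sub>i)\<^sub>i\<close> to it gives a point of the ball (\<open>fock_copy\<close>). Hence \<open>f(rS) = \<theta>(rS) g(rS)\<close> and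
  \<open>\<parallel>f(rS)\<parallel> \<le> 1\<close>. By the radial infimum property, for every \<open>K > 1\<close> there are \<open>r\<close> arbitrarily close
  to \<open>1\<close> with \<open>\<parallel>y\<parallel> \<le> K \<parallel>\<theta>(rS) y\<parallel>\<close> for all \<open>y\<close> (\<open>radial_infimum_lower\<close>); taking \<open>g(rS) y\<close> for \<open>y\<close>
  gives \<open>\<parallel>g(rS)\<parallel> \<le> K\<close>. The noncommutative von Neumann inequality (\<open>von_neumann_inequality\<close>) carries
  this bound to \<open>g(X)\<close> whenever \<open>\<parallel>X\<parallel> < r\<close>.

  \<^emph>\<open>Strictness.\<close> Let \<open>a = g(0)\<close>, so \<open>|a| \<le> 1\<close>. If \<open>|a| = 1\<close>, then \<open>g(rS) 1 = \<Sum>\<^sub>\<alpha> a\<^sub>\<alpha> r\<^bsup>|\<alpha>|\<^esup> e\<^sub>\<alpha>\<close> has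
  norm at most \<open>1\<close>, which leaves no room for a further coefficient, and \<open>g\<close> is constant
  (\<open>coeff_eq_0\<close>). If \<open>|a| < 1\<close>, a Schwarz--Pick estimate (\<open>strict_contraction\<close>) bounds \<open>g(X)\<close> by a
  constant smaller than \<open>1\<close> for each \<open>X\<close> in the ball. This dichotomy decides all the equality cases,
  since \<open>\<theta> \<theta>\<^sup>* - f f\<^sup>* = \<theta> (1 - g g\<^sup>*) \<theta>\<^sup>*\<close>.

  \<^emph>\<open>The common tool\<close> behind the von Neumann inequality and the Schwarz--Pick estimate is the Poisson
  kernel (\<open>poisson_transfer\<close>). For \<open>Y\<close> in the ball and \<open>\<Delta> = 1 - \<Sum>\<^sub>i Y\<^sub>i Y\<^sub>i\<^sup>*\<close>, the map
  \<open>x \<mapsto> (\<Delta>\<^bsup>1/2\<^esup> Y\<^sub>\<alpha>\<^sup>* x)\<^sub>\<alpha>\<close> is isometric (\<open>defect_sum\<close>) and intertwines \<open>g(rY)\<^sup>*\<close> with \<open>g(rS)\<^sup>* \<otimes> 1\<close>.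
  Therefore every quadratic inequality for \<open>g(rS)\<^sup>*\<close> on the Fock space passes to \<open>g(rY)\<^sup>*\<close>. The
  inequality needed for Schwarz--Pick is an elementary fact about a contraction \<open>R\<close> with a unit
  eigenvector (\<open>contraction_eigenvector\<close>), applied to \<open>R = g(rS)\<^sup>*\<close> and the vacuum, an eigenvector
  for the eigenvalue conjugate to \<open>a\<close>.
\<close>

section \<open>Inner products and adjoints\<close>

lemma cinner_scaleC_right: "cinner x (c *\<^sub>C y) = cnj c * cinner x y"
  by (metis cinner_commute cinner_scaleC_left complex_cnj_mult)

lemma Im_cinner: "Im (cinner x y) = inner x (\<i> *\<^sub>C y)"
  by (simp add: Re_cinner[symmetric] cinner_scaleC_right)

lemma norm_cinner_le: "cmod (cinner x y) \<le> norm x * norm y"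
proof -
  obtain c where c: "cmod c = 1" "c * cinner x y = complex_of_real (cmod (cinner x y))"
  proof (cases "cinner x y = 0")
    case False
    show ?thesis
    proof (rule that)
      show "cmod (cnj (sgn (cinner x y))) = 1"
        using False by (simp add: norm_sgn)
      show "cnj (sgn (cinner x y)) * cinner x y = complex_of_real (cmod (cinner x y))"
        using False complex_norm_square[of "cinner x y"]
        by (simp add: sgn_eq power2_eq_square divide_simps mult.commute)
    qed
  qed (use that[of 1] in auto)
  have "cmod (cinner x y) = Re (cinner (c *\<^sub>C x) y)"
    using c by (simp add: cinner_scaleC_left)
  also have "\<dots> \<le> norm (c *\<^sub>C x) * norm y"
    unfolding Re_cinner by (rule norm_cauchy_schwarz)
  finally show ?thesis
    using c by (simp add: norm_scaleC)
qed

lemma bounded_bilinear_cinner: "bounded_bilinear (cinner :: 'a::chilbert_space \<Rightarrow> 'a \<Rightarrow> complex)"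
proof
  fix x y z :: 'a and r :: real
  show add: "cinner (x + y) z = cinner x z + cinner y z"
    by (rule cinner_add_left)
  show "cinner x (y + z) = cinner x y + cinner x z"
    by (metis cinner_commute cinner_add_left complex_cnj_add)
  show "cinner (r *\<^sub>R x) y = r *\<^sub>R cinner x y"
    by (simp add: scaleC_of_real[symmetric] cinner_scaleC_left scaleR_conv_of_real)
  show "cinner x (r *\<^sub>R y) = r *\<^sub>R cinner x y"
    by (simp add: scaleC_of_real[symmetric] cinner_scaleC_right scaleR_conv_of_real)
  show "\<exists>K. \<forall>(x::'a) y. norm (cinner x y) \<le> norm x * norm y * K"
    by (intro exI[of _ 1]) (simp add: norm_cinner_le)
qed

lemmas cinner_add_right = bounded_bilinear.add_right[OF bounded_bilinear_cinner]
  and cinner_diff_left = bounded_bilinear.diff_left[OF bounded_bilinear_cinner]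
  and cinner_diff_right = bounded_bilinear.diff_right[OF bounded_bilinear_cinner]
  and cinner_zero_left [simp] = bounded_bilinear.zero_left[OF bounded_bilinear_cinner]
  and cinner_zero_right [simp] = bounded_bilinear.zero_right[OF bounded_bilinear_cinner]
  and cinner_scaleR_left = bounded_bilinear.scaleR_left[OF bounded_bilinear_cinner]
  and cinner_scaleR_right = bounded_bilinear.scaleR_right[OF bounded_bilinear_cinner]
  and bounded_linear_cinner_left = bounded_bilinear.bounded_linear_left[OF bounded_bilinear_cinner]
  and bounded_linear_cinner_right = bounded_bilinear.bounded_linear_right[OF bounded_bilinear_cinner]

lemma cinner_right_cancel:
  assumes "\<And>x. cinner x y = cinner x z" shows "y = z"
proof -
  have "cinner (y - z) (y - z) = 0"
    using assms[of "y - z"] by (simp add: cinner_diff_right)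
  then show ?thesis
    by (metis Re_cinner inner_eq_zero_iff zero_complex.sel(1) right_minus_eq)
qed

text \<open>
  The representing vector minimizes \<open>\<parallel>x\<parallel>\<^sup>2 - 2 \<phi>(x)\<close>: this functional is bounded below, the
  parallelogram law makes every minimizing sequence Cauchy, and at a minimum the first variation
  vanishes.
\<close>

lemma riesz_representation:
  fixes \<phi> :: "'a::{real_inner,complete_space} \<Rightarrow> real"
  assumes "bounded_linear \<phi>"
  obtains z where "\<And>x. \<phi> x = inner x z"
proof -
  interpret \<phi>: bounded_linear \<phi> by (rule assms)
  obtain K where K: "\<And>x. norm (\<phi> x) \<le> norm x * K"
    using \<phi>.bounded by blast
  define J where "J x = (norm x)\<^sup>2 - 2 * \<phi> x" for x
  have below: "- K\<^sup>2 \<le> J x" for x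
  proof -
    have "\<phi> x \<le> norm x * K" using K[of x] by simp
    moreover have "0 \<le> (norm x - K)\<^sup>2" by simp
    ultimately show ?thesis
      unfolding J_def by (simp add: power2_diff algebra_simps)
  qed
  define m where "m = (INF x. J x)"
  have bdd: "bdd_below (range J)"
    using below by (auto intro!: bdd_belowI)
  have m_le: "m \<le> J x" for x
    unfolding m_def by (rule cINF_lower[OF bdd]) simp
  have "\<exists>x. J x < m + inverse (real (Suc k))" for k
  proof -
    have "m < m + inverse (real (Suc k))" by simp
    then show ?thesis
      unfolding m_def by (subst (asm) cINF_less_iff[OF _ bdd]) auto
  qed
  then obtain s where s: "\<And>k. J (s k) < m + inverse (real (Suc k))"
    by metis
  have near: "(norm (x - y))\<^sup>2 \<le> 2 * J x + 2 * J y - 4 * m" for x y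
  proof -
    have "(norm (x - y))\<^sup>2 = 2 * J x + 2 * J y - 4 * J ((1/2) *\<^sub>R (x + y))"
      unfolding J_def
      by (simp add: power2_norm_eq_inner inner_simps \<phi>.add \<phi>.scaleR algebra_simps inner_commute)
    then show ?thesis using m_le[of "(1/2) *\<^sub>R (x + y)"] by simp
  qed
  have "Cauchy s"
  proof (rule metric_CauchyI)
    fix e :: real assume "e > 0"
    obtain N where N: "inverse (real (Suc N)) < e\<^sup>2 / 4"
      using reals_Archimedean[of "e\<^sup>2 / 4"] \<open>e > 0\<close> by auto
    have small: "4 * J (s k) < 4 * m + e\<^sup>2" if "k \<ge> N" for k
    proof -
      have "inverse (real (Suc k)) \<le> inverse (real (Suc N))"
        using that by (simp add: field_simps)
      then show ?thesis using s[of k] N by linarith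
    qed
    have "dist (s k) (s l) < e" if "k \<ge> N" "l \<ge> N" for k l
    proof -
      have "(norm (s k - s l))\<^sup>2 < e\<^sup>2"
        using near[of "s k" "s l"] small[OF that(1)] small[OF that(2)] by linarith
      then show ?thesis
        using \<open>e > 0\<close> by (simp add: dist_norm power_less_imp_less_base)
    qed
    then show "\<exists>M. \<forall>k\<ge>M. \<forall>l\<ge>M. dist (s k) (s l) < e" by blast
  qed
  then obtain z where z: "s \<longlonglongrightarrow> z"
    using Cauchy_convergent convergent_def by blast
  have "(\<lambda>k. J (s k)) \<longlonglongrightarrow> J z"
    unfolding J_def by (intro tendsto_intros z \<phi>.tendsto)
  moreover have "(\<lambda>k. m + inverse (real (Suc k))) \<longlonglongrightarrow> m + 0"
    by (intro tendsto_intros LIMSEQ_inverse_real_of_nat)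
  ultimately have "J z \<le> m + 0"
    by (rule LIMSEQ_le) (use s less_imp_le in blast)
  then have min: "J z \<le> J x" for x
    using m_le[of x] by simp
  show ?thesis
  proof (rule that[of z])
    fix x
    define p where "p = inner x z - \<phi> x"
    have var: "0 \<le> 2 * t * p + t\<^sup>2 * (norm x)\<^sup>2" for t
    proof -
      have "J (z + t *\<^sub>R x) = J z + 2 * t * p + t\<^sup>2 * (norm x)\<^sup>2"
        unfolding J_def p_def power2_norm_eq_inner
        by (simp add: inner_simps \<phi>.add \<phi>.scaleR algebra_simps inner_commute power2_eq_square)
      then show ?thesis using min[of "z + t *\<^sub>R x"] by simp
    qed
    have "p = 0"
    proof (rule ccontr)
      assume "p \<noteq> 0"
      define n where "n = (norm x)\<^sup>2 + 1"
      have "n > 0" by (simp add: n_def add_nonneg_pos)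
      have "0 \<le> 2 * (- p / n) * p + (- p / n)\<^sup>2 * (norm x)\<^sup>2" by (rule var)
      also have "\<dots> \<le> 2 * (- p / n) * p + (- p / n)\<^sup>2 * n"
        unfolding n_def by (intro add_left_mono mult_left_mono) auto
      also have "\<dots> = - (p\<^sup>2 / n)"
        using \<open>n > 0\<close> by (simp add: power2_eq_square field_simps)
      also have "\<dots> < 0" using \<open>p \<noteq> 0\<close> \<open>n > 0\<close> by simp
      finally show False by simp
    qed
    then show "\<phi> x = inner x z" by (simp add: p_def)
  qed
qed

text \<open>
  Source and target may differ, so that the isometry from the Fock space into another Hilbert
  space can be obtained as an adjoint, too.
\<close>

lemma adjoint_exists:
  fixes A :: "'a::chilbert_space \<Rightarrow>\<^sub>L 'b::chilbert_space"
  assumes A: "\<And>c x. A (c *\<^sub>C x) = c *\<^sub>C A x"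
  obtains B :: "'b \<Rightarrow>\<^sub>L 'a"
  where "\<And>x y. cinner (A x) y = cinner x (B y)" "\<And>c y. B (c *\<^sub>C y) = c *\<^sub>C B y"
proof -
  have "\<exists>z. \<forall>x. inner (A x) y = inner x z" for y
  proof -
    have "bounded_linear (\<lambda>x. inner (A x) y)"
      by (intro bounded_linear_intros)
    then show ?thesis
      using riesz_representation[of "\<lambda>x. inner (A x) y"] by metis
  qed
  then obtain B where B: "\<And>x y. inner (A x) y = inner x (B y)"
    by metis
  have eq: "u = v" if "\<And>x. inner x u = inner x v" for u v :: 'a
  proof -
    have "inner (u - v) (u - v) = 0"
      using that[of "u - v"] by (simp add: inner_diff_right)
    then show ?thesis by simp
  qed
  have Bc: "B (c *\<^sub>C y) = c *\<^sub>C B y" for c y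
  proof (rule eq)
    fix x
    have adj: "inner (cnj c *\<^sub>C u) v = inner u (c *\<^sub>C v)" for u v :: "'w::chilbert_space"
      by (simp add: Re_cinner[symmetric] cinner_scaleC_left cinner_scaleC_right)
    show "inner x (B (c *\<^sub>C y)) = inner x (c *\<^sub>C B y)"
      by (simp add: B[symmetric] adj[symmetric] A)
  qed
  have "bounded_linear B"
  proof (rule bounded_linear_intro[where K = "norm A"])
    show "B (x + y) = B x + B y" for x y
      by (rule eq) (simp add: B[symmetric] inner_add_right)
    show "B (r *\<^sub>R x) = r *\<^sub>R B x" for r x
      by (rule eq) (simp add: B[symmetric])
    show "norm (B y) \<le> norm y * norm A" for y
    proof (cases "B y = 0")
      case False
      have "norm (B y) * norm (B y) = inner (A (B y)) y"
        by (simp add: B power2_norm_eq_inner[symmetric] power2_eq_square)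
      also have "\<dots> \<le> norm (A (B y)) * norm y"
        by (rule norm_cauchy_schwarz)
      also have "\<dots> \<le> (norm A * norm (B y)) * norm y"
        by (intro mult_right_mono norm_blinfun) simp
      finally show ?thesis
        using False by (simp add: mult.commute)
    qed simp
  qed
  then have ap: "blinfun_apply (Blinfun B) = B"
    by (rule bounded_linear_Blinfun_apply)
  show ?thesis
  proof (rule that[of "Blinfun B"])
    show "cinner (A x) y = cinner x (Blinfun B y)" for x y
      by (rule complex_eqI) (simp_all add: ap Re_cinner Im_cinner B Bc[symmetric])
  qed (simp add: ap Bc)
qed

lemma bounded_opsD: "A \<in> bounded_ops \<Longrightarrow> A (c *\<^sub>C x) = c *\<^sub>C A x"
  by (simp add: bounded_ops_def)

lemma adj_eqI:
  fixes A B :: "'h::chilbert_space \<Rightarrow>\<^sub>L 'h"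
  assumes "\<And>x y. cinner (A x) y = cinner x (B y)"
  shows "adj A = B"
  unfolding adj_def
proof (rule the_equality)
  fix C :: "'h \<Rightarrow>\<^sub>L 'h" assume C: "\<forall>x y. cinner (A x) y = cinner x (C y)"
  show "C = B"
    by (rule blinfun_eqI, rule cinner_right_cancel) (simp add: C[rule_format, symmetric] assms)
qed (simp add: assms)

lemma
  fixes A :: "'h::chilbert_space \<Rightarrow>\<^sub>L 'h"
  assumes "A \<in> bounded_ops"
  shows cinner_adj: "cinner (A x) y = cinner x (adj A y)"
    and adj_bounded_ops: "adj A \<in> bounded_ops"
proof -
  obtain B :: "'h \<Rightarrow>\<^sub>L 'h"
    where B: "\<And>x y. cinner (A x) y = cinner x (B y)" "\<And>c y. B (c *\<^sub>C y) = c *\<^sub>C B y"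
    by (rule adjoint_exists[OF bounded_opsD[OF assms]]) (rule that)
  have "adj A = B" by (rule adj_eqI) (rule B)
  with B show "cinner (A x) y = cinner x (adj A y)" "adj A \<in> bounded_ops"
    by (simp_all add: bounded_ops_def)
qed

lemma cinner_adj': "A \<in> bounded_ops \<Longrightarrow> cinner (adj A x) y = cinner x (A y)"
  by (simp add: cinner_commute[of "adj A x"] cinner_commute[of x "A y"] cinner_adj)

lemma bounded_ops_compose: "A \<in> bounded_ops \<Longrightarrow> B \<in> bounded_ops \<Longrightarrow> A o\<^sub>L B \<in> bounded_ops"
  by (simp add: bounded_ops_def)

lemma bounded_ops_id: "id_blinfun \<in> bounded_ops"
  by (simp add: bounded_ops_def)

lemma bounded_ops_diff: "A \<in> bounded_ops \<Longrightarrow> B \<in> bounded_ops \<Longrightarrow> A - B \<in> bounded_ops"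
  by (simp add: bounded_ops_def blinfun.bilinear_simps complex_vector.scale_right_diff_distrib)

lemma scaleR_scaleC_commute: "r *\<^sub>R c *\<^sub>C x = c *\<^sub>C r *\<^sub>R (x::'a::chilbert_space)"
  by (simp add: scaleC_of_real[symmetric] scaleC_scaleC mult.commute)

lemma bounded_ops_scaleR: "A \<in> bounded_ops \<Longrightarrow> r *\<^sub>R A \<in> bounded_ops"
  by (simp add: bounded_ops_def blinfun.bilinear_simps scaleR_scaleC_commute)

lemma adj_compose:
  "A \<in> bounded_ops \<Longrightarrow> B \<in> bounded_ops \<Longrightarrow> adj (A o\<^sub>L B) = adj B o\<^sub>L adj A"
  by (rule adj_eqI) (simp add: cinner_adj)

lemma adj_id: "adj id_blinfun = id_blinfun"
  by (rule adj_eqI) simp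

lemma adj_scaleR: "A \<in> bounded_ops \<Longrightarrow> adj (r *\<^sub>R A) = r *\<^sub>R adj A"
  by (rule adj_eqI) (simp add: blinfun.scaleR_left cinner_adj cinner_scaleR_left cinner_scaleR_right)

lemma adj_scalar_op: "adj (scalar_op c) = scalar_op (cnj c)"
  by (rule adj_eqI) (simp add: cinner_scaleC_left cinner_scaleC_right)

text \<open>
  The estimates below are obtained for adjoints, because it is the adjoint that the Poisson kernel
  intertwines; this brings them back.
\<close>

lemma norm_le_if_adj_le:
  fixes A :: "'a::chilbert_space \<Rightarrow>\<^sub>L 'a"
  assumes A: "A \<in> bounded_ops" and "0 \<le> k" and le: "\<And>x. norm (adj A x) \<le> k * norm x"
  shows "norm A \<le> k"
proof (rule norm_blinfun_bound[OF \<open>0 \<le> k\<close>])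
  fix x
  show "norm (A x) \<le> k * norm x"
  proof (cases "A x = 0")
    case False
    have "norm (A x) * norm (A x) = inner x (adj A (A x))"
      by (simp add: Re_cinner[symmetric] cinner_adj[OF A, symmetric] cinner_self power2_eq_square)
    also have "\<dots> \<le> norm x * norm (adj A (A x))"
      by (rule norm_cauchy_schwarz)
    also have "\<dots> \<le> norm x * (k * norm (A x))"
      by (intro mult_left_mono le) simp
    finally show ?thesis using False by (simp add: mult.commute)
  qed (simp add: \<open>0 \<le> k\<close>)
qed

lemma norm_adj_le:
  fixes A :: "'h::chilbert_space \<Rightarrow>\<^sub>L 'h"
  assumes A: "A \<in> bounded_ops"
  shows "norm (adj A x) \<le> norm A * norm x"
proof -
  have "adj (adj A) = A" by (rule adj_eqI) (rule cinner_adj'[OF A])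
  then have "norm (adj A) \<le> norm A"
    by (intro norm_le_if_adj_le adj_bounded_ops A) (simp_all add: norm_blinfun)
  then have "norm (adj A) * norm x \<le> norm A * norm x"
    by (rule mult_right_mono) simp
  then show ?thesis
    using norm_blinfun[of "adj A" x] by (rule order_trans[rotated])
qed

lemma norm_scalar_op:
  assumes "(v::'h::chilbert_space) \<noteq> 0"
  shows "norm (scalar_op c :: 'h \<Rightarrow>\<^sub>L 'h) = cmod c"
proof (rule antisym)
  show "norm (scalar_op c :: 'h \<Rightarrow>\<^sub>L 'h) \<le> cmod c"
    by (rule norm_blinfun_bound) (simp_all add: norm_scaleC)
  show "cmod c \<le> norm (scalar_op c :: 'h \<Rightarrow>\<^sub>L 'h)"
    using norm_blinfun[of "scalar_op c" v] assms by (simp add: norm_scaleC)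
qed

section \<open>Positive invertible operators\<close>

lemma positive_op_iff:
  "positive_op A \<longleftrightarrow> A \<in> bounded_ops \<and> (\<forall>x. Im (cinner (A x) x) = 0 \<and> 0 \<le> inner (A x) x)"
  by (auto simp: positive_op_def complex_nonneg_Reals_iff Re_cinner)

lemma positive_op_selfadjoint:
  fixes A :: "'h::chilbert_space \<Rightarrow>\<^sub>L 'h"
  assumes "positive_op A"
  shows "cinner (A x) y = cinner x (A y)"
proof -
  have bo: "A \<in> bounded_ops" and re: "cnj (cinner (A x) x) = cinner (A x) x" for x
    using assms by (auto simp: positive_op_iff complex_eq_iff)
  have re': "cinner x (A x) = cinner (A x) x" for x
    using re[of x] cinner_commute[of x "A x"] by simp
  define d where "d x y = cinner (A x) y - cinner x (A y)" for x y
  have a: "d x y + d y x = 0" for x y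
    using re'[of "x + y"] re'[of x] re'[of y]
    by (simp add: d_def blinfun.bilinear_simps cinner_add_left cinner_add_right algebra_simps)
  have "d (\<i> *\<^sub>C x) y + d y (\<i> *\<^sub>C x) = 0" by (rule a)
  then have "\<i> * (d x y - d y x) = 0"
    by (simp add: d_def bounded_opsD[OF bo] cinner_scaleC_left cinner_scaleC_right algebra_simps)
  with a[of x y] have "d x y = 0" by (simp add: eq_diff_eq)
  then show ?thesis by (simp add: d_def)
qed

text \<open>
  Together with the next lemma: a positive operator is invertible iff it is bounded below.
  Invertibility gives the bound by the Cauchy-Schwarz inequality for the form
  \<open>\<langle>Ax, y\<rangle>\<close>. Conversely, given the bound, \<open>x \<mapsto> x - t (A x - y)\<close> is a contraction for small
  \<open>t > 0\<close> and its fixed point solves \<open>A x = y\<close>.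
\<close>

lemma positive_invertible_bounded_below:
  fixes A :: "'h::chilbert_space \<Rightarrow>\<^sub>L 'h"
  assumes pos: "positive_op A" and inv: "invertible_op A"
  obtains c where "c > 0" "\<And>x. c * (norm x)\<^sup>2 \<le> inner (A x) x"
proof -
  obtain B where BA: "B o\<^sub>L A = id_blinfun"
    using inv by (auto simp: invertible_op_def)
  define p where "p = norm A + 1"
  have "p > 0" by (simp add: p_def add_nonneg_pos)
  have nonneg: "0 \<le> inner (A x) x" for x
    using pos by (simp add: positive_op_iff)
  have sa: "inner (A x) y = inner x (A y)" for x y
    by (simp add: Re_cinner[symmetric] positive_op_selfadjoint[OF pos])
  have upper: "(norm (A x))\<^sup>2 \<le> p * inner (A x) x" for x
  proof -
    let ?u = "x - (1 / p) *\<^sub>R A x"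
    have "inner (A ?u) ?u = inner (A x) x - 2 / p * (norm (A x))\<^sup>2
        + (1 / p)\<^sup>2 * inner (A (A x)) (A x)"
      using sa[of "A x" x] unfolding power2_norm_eq_inner
      by (simp add: blinfun.bilinear_simps inner_simps power2_eq_square inner_commute algebra_simps)
    moreover have "inner (A (A x)) (A x) \<le> p * (norm (A x))\<^sup>2"
    proof -
      have "inner (A (A x)) (A x) \<le> norm (A (A x)) * norm (A x)"
        by (rule norm_cauchy_schwarz)
      also have "\<dots> \<le> (norm A * norm (A x)) * norm (A x)"
        by (intro mult_right_mono norm_blinfun) simp
      also have "\<dots> \<le> p * (norm (A x))\<^sup>2"
        by (simp add: p_def power2_eq_square algebra_simps)
      finally show ?thesis .
    qed
    then have "(1 / p)\<^sup>2 * inner (A (A x)) (A x) \<le> (1 / p)\<^sup>2 * (p * (norm (A x))\<^sup>2)"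
      by (intro mult_left_mono) auto
    moreover have "(1 / p)\<^sup>2 * (p * (norm (A x))\<^sup>2) = 1 / p * (norm (A x))\<^sup>2"
      using \<open>p > 0\<close> by (simp add: power2_eq_square)
    ultimately have "0 \<le> inner (A x) x - 1 / p * (norm (A x))\<^sup>2"
      using nonneg[of ?u] by (simp add: field_simps)
    then show ?thesis
      using \<open>p > 0\<close> by (simp add: field_simps)
  qed
  define b where "b = norm B + 1"
  have "b > 0" by (simp add: b_def add_nonneg_pos)
  have lower: "(norm x)\<^sup>2 \<le> b\<^sup>2 * (norm (A x))\<^sup>2" for x
  proof -
    have "norm x = norm (B (A x))"
      using BA by (metis blinfun_apply_blinfun_compose blinfun_apply_id_blinfun)
    also have "\<dots> \<le> norm B * norm (A x)" by (rule norm_blinfun)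
    also have "\<dots> \<le> b * norm (A x)" by (simp add: b_def mult_right_mono)
    finally have "(norm x)\<^sup>2 \<le> (b * norm (A x))\<^sup>2" by (intro power_mono) auto
    then show ?thesis by (simp add: power_mult_distrib)
  qed
  show ?thesis
  proof (rule that[of "1 / (b\<^sup>2 * p)"])
    show "1 / (b\<^sup>2 * p) > 0" using \<open>b > 0\<close> \<open>p > 0\<close> by simp
    fix x
    have "(norm x)\<^sup>2 \<le> b\<^sup>2 * (p * inner (A x) x)"
      using lower[of x] mult_left_mono[OF upper[of x], of "b\<^sup>2"] by simp
    then show "1 / (b\<^sup>2 * p) * (norm x)\<^sup>2 \<le> inner (A x) x"
      using \<open>b > 0\<close> \<open>p > 0\<close> by (simp add: field_simps)
  qed
qed

lemma bounded_below_invertible: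
  fixes A :: "'h::chilbert_space \<Rightarrow>\<^sub>L 'h"
  assumes A: "A \<in> bounded_ops" and "c > 0" and low: "\<And>x. c * (norm x)\<^sup>2 \<le> inner (A x) x"
  shows "invertible_op A"
proof -
  define M where "M = norm A + c"
  have "M > 0" using \<open>c > 0\<close> by (simp add: M_def add_nonneg_pos)
  define t where "t = c / M\<^sup>2"
  have "t > 0" using \<open>c > 0\<close> \<open>M > 0\<close> by (simp add: t_def)
  have M: "norm (A x) \<le> M * norm x" for x
    using norm_blinfun[of A x] \<open>c > 0\<close> by (simp add: M_def algebra_simps add_increasing)
  define k where "k = 1 - c\<^sup>2 / M\<^sup>2"
  have "k < 1" using \<open>c > 0\<close> \<open>M > 0\<close> by (simp add: k_def)
  have "k \<ge> 0"
  proof -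
    have "c\<^sup>2 \<le> M\<^sup>2" using \<open>c > 0\<close> by (intro power_mono) (simp_all add: M_def)
    then show ?thesis using \<open>M > 0\<close> by (simp add: k_def)
  qed
  have shrink: "norm (x - t *\<^sub>R A x) \<le> sqrt k * norm x" for x
  proof -
    have "(norm (x - t *\<^sub>R A x))\<^sup>2 = (norm x)\<^sup>2 - 2 * t * inner (A x) x + t\<^sup>2 * (norm (A x))\<^sup>2"
      unfolding power2_norm_eq_inner
      by (simp add: inner_simps inner_commute power2_eq_square algebra_simps)
    also have "\<dots> \<le> (norm x)\<^sup>2 - 2 * t * (c * (norm x)\<^sup>2) + t\<^sup>2 * (M * norm x)\<^sup>2"
      using \<open>t > 0\<close> by (intro add_mono diff_mono mult_left_mono low power_mono M) auto
    also have "\<dots> = k * (norm x)\<^sup>2"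
      using \<open>M > 0\<close> by (simp add: t_def k_def power2_eq_square field_simps)
    also have "\<dots> = (sqrt k * norm x)\<^sup>2"
      using \<open>k \<ge> 0\<close> by (simp add: power_mult_distrib)
    finally show ?thesis
      using \<open>k \<ge> 0\<close> by (simp add: power2_le_iff_abs_le abs_mult)
  qed
  have surj: "\<exists>x. A x = y" for y
  proof -
    have "\<exists>!x\<in>UNIV. x - t *\<^sub>R (A x - y) = x"
    proof (rule Banach_fix[of UNIV "sqrt k"])
      show "complete (UNIV :: 'h set)" by (rule complete_UNIV)
      show "dist (x - t *\<^sub>R (A x - y)) (z - t *\<^sub>R (A z - y)) \<le> sqrt k * dist x z" for x z
        using shrink[of "x - z"]
        by (simp add: dist_norm blinfun.bilinear_simps algebra_simps)
    qed (use \<open>k \<ge> 0\<close> \<open>k < 1\<close> in auto)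
    then show ?thesis using \<open>t > 0\<close> by auto
  qed
  have below: "c * norm x \<le> norm (A x)" for x
  proof (cases "x = 0")
    case False
    have "c * norm x * norm x \<le> norm (A x) * norm x"
      using low[of x] norm_cauchy_schwarz[of "A x" x] by (simp add: power2_eq_square)
    then show ?thesis using False by simp
  qed simp
  have inj: "x = z" if "A x = A z" for x z
    using below[of "x - z"] that \<open>c > 0\<close> by (simp add: blinfun.bilinear_simps mult_le_0_iff)
  obtain B where B: "\<And>y. A (B y) = y" using surj by metis
  have "bounded_linear B"
  proof (rule bounded_linear_intro[where K = "1 / c"])
    show "B (x + y) = B x + B y" for x y
      by (rule inj) (simp add: B blinfun.bilinear_simps)
    show "B (r *\<^sub>R x) = r *\<^sub>R B x" for r x
      by (rule inj) (simp add: B blinfun.bilinear_simps)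
    show "norm (B y) \<le> norm y * (1 / c)" for y
      using below[of "B y"] \<open>c > 0\<close> by (simp add: B field_simps)
  qed
  then have ap: "blinfun_apply (Blinfun B) = B"
    by (rule bounded_linear_Blinfun_apply)
  show ?thesis
    unfolding invertible_op_def
  proof (rule bexI[of _ "Blinfun B"], intro conjI blinfun_eqI)
    show "(A o\<^sub>L Blinfun B) x = id_blinfun x" for x by (simp add: ap B)
    show "(Blinfun B o\<^sub>L A) x = id_blinfun x" for x
      by (simp add: ap) (rule inj, simp add: B)
    have "B (d *\<^sub>C x) = d *\<^sub>C B x" for d x
      by (rule inj) (simp add: B bounded_opsD[OF A])
    then show "Blinfun B \<in> bounded_ops" by (simp add: bounded_ops_def ap)
  qed
qed

section \<open>Orthonormal families\<close>

text \<open>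
  Orthonormality is needed with respect to the inner product, to embed the Fock space, and with
  respect to the form of the operator \<open>1 - \<Sum>\<^sub>i Y\<^sub>i Y\<^sub>i\<^sup>*\<close>. The form takes the place
  of the square root of that operator.
\<close>

locale positive_form =
  fixes B :: "'a::chilbert_space \<Rightarrow> 'a \<Rightarrow> complex"
  assumes add_left: "B (x + y) z = B x z + B y z"
    and scale_left: "B (c *\<^sub>C x) y = c * B x y"
    and sym: "B x y = cnj (B y x)"
    and pos: "x \<noteq> 0 \<Longrightarrow> 0 < Re (B x x)"
begin

definition orthonormal :: "'a set \<Rightarrow> bool" where
  "orthonormal E \<longleftrightarrow> (\<forall>e\<in>E. \<forall>e'\<in>E. B e e' = (if e = e' then 1 else 0))"

definition proj :: "'a set \<Rightarrow> 'a \<Rightarrow> 'a" where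
  "proj E u = (\<Sum>e\<in>E. B u e *\<^sub>C e)"

lemma zero_left [simp]: "B 0 y = 0"
  using add_left[of 0 0 y] by simp

lemma zero_right [simp]: "B x 0 = 0"
  using sym[of x 0] by simp

lemma diff_left: "B (x - y) z = B x z - B y z"
  using add_left[of "x - y" y z] by simp

lemma diff_right: "B x (y - z) = B x y - B x z"
  using diff_left[of y z x] sym[of x] by (metis complex_cnj_diff)

lemma scale_right: "B x (c *\<^sub>C y) = cnj c * B x y"
  using scale_left[of c y x] sym[of x] by (metis complex_cnj_mult)

lemma sum_left: "B (sum f A) y = (\<Sum>i\<in>A. B (f i) y)"
  by (induction A rule: infinite_finite_induct) (simp_all add: add_left)

lemma self_real: "B x x = complex_of_real (Re (B x x))"
  using arg_cong[OF sym[of x x], of Im] by (simp add: complex_eq_iff)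

lemma nonneg: "0 \<le> Re (B x x)"
  using pos[of x] by (cases "x = 0") auto

lemma proj_left:
  assumes "finite E" "orthonormal E" "e \<in> E"
  shows "B (proj E u) e = B u e"
proof -
  have "B (proj E u) e = (\<Sum>e'\<in>E. if e' = e then B u e' else 0)"
    unfolding proj_def sum_left
    by (rule sum.cong) (use assms in \<open>auto simp: orthonormal_def scale_left\<close>)
  then show ?thesis using assms by simp
qed

lemma residual:
  assumes "finite E" "orthonormal E"
  shows "Re (B (u - proj E u) (u - proj E u)) = Re (B u u) - (\<Sum>e\<in>E. (cmod (B u e))\<^sup>2)"
    and "B (proj E u) (u - proj E u) = 0"
proof -
  define w where "w = u - proj E u"
  have "B e w = 0" if "e \<in> E" for e
    using sym[of e w] proj_left[OF assms that] by (simp add: w_def diff_left)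
  then have p: "B (proj E u) w = 0"
    unfolding proj_def sum_left by (simp add: scale_left)
  then show "B (proj E u) (u - proj E u) = 0" by (simp add: w_def)
  have "B w w = B w u - B w (proj E u)"
    unfolding w_def diff_right ..
  also have "B w (proj E u) = 0"
    using p sym[of w "proj E u"] by simp
  also have "B w u = B u u - B (proj E u) u"
    unfolding w_def diff_left ..
  also have "B (proj E u) u = (\<Sum>e\<in>E. complex_of_real ((cmod (B u e))\<^sup>2))"
    unfolding proj_def sum_left scale_left complex_norm_square using sym[of _ u] by simp
  finally show "Re (B (u - proj E u) (u - proj E u)) = Re (B u u) - (\<Sum>e\<in>E. (cmod (B u e))\<^sup>2)"
    by (simp add: w_def)
qed

lemma bessel:
  assumes "finite E" "orthonormal E"
  shows "(\<Sum>e\<in>E. (cmod (B u e))\<^sup>2) \<le> Re (B u u)"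
  using residual(1)[OF assms, of u] nonneg[of "u - proj E u"] by simp

text \<open>
  The new vector is the normalized residual of \<open>u\<close>.
\<close>

lemma orthonormal_extend:
  assumes E: "finite E" "orthonormal E" and u: "proj E u \<noteq> u"
  obtains e where "e \<notin> E" "orthonormal (insert e E)"
    "(\<Sum>e\<in>insert e E. (cmod (B u e))\<^sup>2) = Re (B u u)"
proof -
  define w where "w = u - proj E u"
  define s where "s = Re (B w w)"
  have "s > 0" using pos[of w] u by (simp add: w_def s_def)
  have ww: "B w w = complex_of_real s"
    unfolding s_def by (rule self_real)
  define e where "e = complex_of_real (1 / sqrt s) *\<^sub>C w"
  have sq: "complex_of_real (sqrt s) * complex_of_real (sqrt s) = complex_of_real s"
    using \<open>s > 0\<close> by (simp flip: of_real_mult)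
  have ee: "B e e = 1"
    using \<open>s > 0\<close> sq by (simp add: e_def scale_left scale_right ww field_simps)
  have "B w e' = 0" if "e' \<in> E" for e'
    using proj_left[OF E that] by (simp add: w_def diff_left)
  then have perp: "B e e' = 0" "B e' e = 0" if "e' \<in> E" for e'
    using that sym[of e' e] by (simp_all add: e_def scale_left)
  have "e \<notin> E" using perp(1)[of e] ee by auto
  have ortho: "orthonormal (insert e E)"
    using E(2) ee perp \<open>e \<notin> E\<close> by (auto simp: orthonormal_def)
  have "B u e = B w e + B (proj E u) e"
    by (simp add: w_def diff_left)
  also have "B (proj E u) e = 0"
    using residual(2)[OF E, of u] by (simp add: e_def scale_right w_def)
  also have "B w e + 0 = complex_of_real (sqrt s)"
    using \<open>s > 0\<close> sq by (simp add: e_def scale_right ww field_simps)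
  finally have "(cmod (B u e))\<^sup>2 = s"
    using \<open>s > 0\<close> by simp
  also have "s = Re (B u u) - (\<Sum>e\<in>E. (cmod (B u e))\<^sup>2)"
    using residual(1)[OF E, of u] by (simp add: s_def w_def)
  finally show ?thesis
    using that[OF \<open>e \<notin> E\<close> ortho] \<open>e \<notin> E\<close> E(1) by simp
qed

text \<open>
  \<open>E\<close> is characterized by Parseval's identity on \<open>U\<close>, not by its span, since the identity is what
  gets used; by Bessel's inequality it persists when \<open>E\<close> grows.
\<close>

lemma gram_schmidt:
  assumes "finite U"
  obtains E where "finite E" "orthonormal E"
    "\<And>u. u \<in> U \<Longrightarrow> (\<Sum>e\<in>E. (cmod (B u e))\<^sup>2) = Re (B u u)"
proof -
  have "\<exists>E. finite E \<and> orthonormal E \<and> (\<forall>u\<in>U. (\<Sum>e\<in>E. (cmod (B u e))\<^sup>2) = Re (B u u))"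
    using assms
  proof (induction U rule: finite_induct)
    case empty
    have "finite {} \<and> orthonormal {} \<and> (\<forall>u\<in>{}. (\<Sum>e\<in>{}. (cmod (B u e))\<^sup>2) = Re (B u u))"
      by (simp add: orthonormal_def)
    then show ?case by blast
  next
    case (insert u U)
    then obtain E where E: "finite E" "orthonormal E"
      and U: "\<And>u. u \<in> U \<Longrightarrow> (\<Sum>e\<in>E. (cmod (B u e))\<^sup>2) = Re (B u u)"
      by blast
    show ?case
    proof (cases "proj E u = u")
      case True
      then have "(\<Sum>e\<in>E. (cmod (B u e))\<^sup>2) = Re (B u u)"
        using residual(1)[OF E, of u] by simp
      then show ?thesis using E U by blast
    next
      case False
      then obtain e where e: "e \<notin> E" "orthonormal (insert e E)"
        "(\<Sum>e\<in>insert e E. (cmod (B u e))\<^sup>2) = Re (B u u)"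
        using orthonormal_extend[OF E] by blast
      have "(\<Sum>e\<in>insert e E. (cmod (B v e))\<^sup>2) = Re (B v v)" if "v \<in> U" for v
      proof (rule antisym)
        show "(\<Sum>e\<in>insert e E. (cmod (B v e))\<^sup>2) \<le> Re (B v v)"
          using E e by (intro bessel) auto
        show "Re (B v v) \<le> (\<Sum>e\<in>insert e E. (cmod (B v e))\<^sup>2)"
          using U[OF that] E e by simp
      qed
      with e E show ?thesis by (intro exI[of _ "insert e E"]) auto
    qed
  qed
  then show ?thesis using that by blast
qed

end

interpretation cinner: positive_form "cinner :: 'a::chilbert_space \<Rightarrow> 'a \<Rightarrow> complex"
proof
  show "cinner x y = cnj (cinner y x)" for x y :: 'a by (rule cinner_commute)
qed (simp_all add: cinner_add_left cinner_scaleC_left Re_cinner)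

text \<open>
  A maximal orthonormal set that is finite spans the space.
\<close>

lemma infinite_orthonormal_set:
  assumes inf: "\<not> (\<exists>B :: 'h::chilbert_space set. finite B \<and> complex_vector.span B = UNIV)"
  obtains E :: "'h::chilbert_space set" where "infinite E" "cinner.orthonormal E"
proof -
  let ?S = "{E :: 'h set. cinner.orthonormal E}"
  have "\<exists>M\<in>?S. \<forall>E\<in>?S. M \<subseteq> E \<longrightarrow> E = M"
  proof (rule subset_Zorn')
    fix C assume C: "subset.chain ?S C"
    show "\<Union>C \<in> ?S"
      unfolding mem_Collect_eq cinner.orthonormal_def
    proof (intro ballI)
      fix e e' assume "e \<in> \<Union>C" "e' \<in> \<Union>C"
      then obtain E E' where "e \<in> E" "E \<in> C" "e' \<in> E'" "E' \<in> C" by blast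
      moreover from this have "E \<subseteq> E' \<or> E' \<subseteq> E"
        using C by (auto simp: subset.chain_def)
      ultimately obtain F where "F \<in> C" "e \<in> F" "e' \<in> F" by blast
      moreover have "cinner.orthonormal F"
        using C \<open>F \<in> C\<close> by (auto simp: subset.chain_def)
      ultimately show "cinner e e' = (if e = e' then 1 else 0)"
        by (simp add: cinner.orthonormal_def)
    qed
  qed
  then obtain M :: "'h set" where M: "cinner.orthonormal M"
    and max: "\<forall>E. cinner.orthonormal E \<longrightarrow> M \<subseteq> E \<longrightarrow> E = M"
    by auto
  have "infinite M"
  proof
    assume fin: "finite M"
    have "u \<in> complex_vector.span M" for u
    proof -
      have "cinner.proj M u = u"
      proof (rule ccontr)
        assume "cinner.proj M u \<noteq> u"
        then obtain e where e: "e \<notin> M" "cinner.orthonormal (insert e M)"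
          by (rule cinner.orthonormal_extend[OF fin M])
        then have "insert e M = M" using max by (simp add: subset_insertI)
        then show False using e by auto
      qed
      moreover have "cinner.proj M u \<in> complex_vector.span M"
        unfolding cinner.proj_def
        by (intro complex_vector.span_sum complex_vector.span_scale complex_vector.span_base)
      ultimately show ?thesis by simp
    qed
    then show False using inf fin by blast
  qed
  then show ?thesis using that M by blast
qed

lemma norm_diff_proj_unit:
  assumes "norm e = 1"
  shows "(norm (v - cinner v e *\<^sub>C e))\<^sup>2 = (norm v)\<^sup>2 - (cmod (cinner v e))\<^sup>2"
proof -
  have "cinner.orthonormal {e}"
    using assms by (simp add: cinner.orthonormal_def cinner_self)
  then show ?thesis
    using cinner.residual(1)[of "{e}" v]
    by (simp add: cinner.proj_def Re_cinner power2_norm_eq_inner)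
qed

section \<open>The Fock space\<close>

definition ket :: "'a \<Rightarrow> 'a ell2" where
  "ket i = Abs_ell2 (\<lambda>j. if j = i then 1 else 0)"

lemma coord_ket: "coord (ket i) j = (if j = i then 1 else 0)"
proof -
  have "(\<lambda>j. (cmod (if j = i then 1 else 0))\<^sup>2) summable_on {i}"
    by simp
  then have "(\<lambda>j. (cmod (if j = i then 1 else 0))\<^sup>2) summable_on UNIV"
    by (rule summable_on_cong_neutral[THEN iffD1, rotated -1]) auto
  then show ?thesis
    unfolding ket_def by (subst coord_Abs) auto
qed

lemma cinner_ket: "cinner y (ket i) = coord y i"
proof -
  have "cinner y (ket i) = (\<Sum>\<^sub>\<infinity>j\<in>{i}. coord y j * cnj (coord (ket i) j))"
    unfolding cinner_ell2_def by (rule infsum_cong_neutral) (auto simp: coord_ket)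
  then show ?thesis by (simp add: coord_ket)
qed

lemma norm_ket: "norm (ket i) = 1"
proof -
  have "complex_of_real ((norm (ket i))\<^sup>2) = complex_of_real 1"
    unfolding cinner_self[symmetric] by (simp add: cinner_ket coord_ket)
  then have "(norm (ket i))\<^sup>2 = 1\<^sup>2"
    unfolding of_real_eq_iff by simp
  then show ?thesis
    by (rule power2_eq_imp_eq) simp_all
qed

lemma coord_sum: "coord (sum f A) \<alpha> = (\<Sum>i\<in>A. coord (f i) \<alpha>)"
  by (induction A rule: infinite_finite_induct) simp_all

lemma creation_bounded_ops: "creation i \<in> bounded_ops"
  unfolding bounded_ops_def mem_Collect_eq creation_apply
  by (intro allI ell2_eqI) (simp add: coord_tensor_left split: list.splits)

lemma creation_ket: "creation i (ket \<alpha>) = ket (i # \<alpha>)"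
  by (rule ell2_eqI) (auto simp: creation_apply coord_tensor_left coord_ket split: list.splits)

lemma coord_adj_creation: "coord (adj (creation i) y) \<alpha> = coord y (i # \<alpha>)"
  by (simp add: cinner_ket[symmetric] cinner_adj'[OF creation_bounded_ops] creation_ket)

lemmas blinfun_compose_scaleR =
  bounded_bilinear.scaleR_left[OF bounded_bilinear_blinfun_compose]
  bounded_bilinear.scaleR_right[OF bounded_bilinear_blinfun_compose]

lemma word_op_scaleR: "word_op (\<lambda>i. r *\<^sub>R X i) \<alpha> = r ^ length \<alpha> *\<^sub>R word_op X \<alpha>"
  by (induction \<alpha>) (simp_all add: blinfun_compose_scaleR)

lemma word_op_creation_ket: "word_op creation \<beta> (ket \<alpha>) = ket (\<beta> @ \<alpha>)"
  by (induction \<beta>) (simp_all add: creation_ket)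

lemma word_op_bounded_ops:
  assumes "\<And>i. X i \<in> bounded_ops"
  shows "word_op X \<alpha> \<in> bounded_ops"
  by (induction \<alpha>) (simp_all add: bounded_ops_id bounded_ops_compose assms)

lemma scalar_op_bounded_ops: "scalar_op c \<in> bounded_ops"
  by (simp add: bounded_ops_def scaleC_scaleC mult.commute)

text \<open>
  The term at \<open>i\<close> keeps the coordinates of \<open>y\<close> at the words that start with \<open>i\<close>, so only the vacuum
  coordinate gets lost.
\<close>

lemma sum_creation_adj:
  fixes y :: "'n fock"
  shows "((\<lambda>i. creation i (adj (creation i) y)) has_sum (y - coord y [] *\<^sub>C ket [])) UNIV"
proof -
  let ?f = "\<lambda>i. creation i (adj (creation i) y)"
  let ?s = "y - coord y [] *\<^sub>C ket []"
  have "\<exists>X. finite X \<and> (\<forall>Y. finite Y \<and> X \<subseteq> Y \<longrightarrow> dist (sum ?f Y) ?s < e)" if "e > 0" for e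
  proof -
    obtain F where F: "finite F"
      and Fe: "dist (\<Sum>\<alpha>\<in>F. (cmod (coord y \<alpha>))\<^sup>2) ((norm y)\<^sup>2) \<le> (e / 2)\<^sup>2"
    proof -
      have "((\<lambda>\<alpha>. (cmod (coord y \<alpha>))\<^sup>2) has_sum (norm y)\<^sup>2) UNIV"
        unfolding ell2_norm_sq by (rule has_sum_infsum[OF coord_summable])
      then show ?thesis
        using has_sum_finite_approximation[of "\<lambda>\<alpha>. (cmod (coord y \<alpha>))\<^sup>2" UNIV _ "(e / 2)\<^sup>2"]
          \<open>e > 0\<close> that by fastforce
    qed
    have "dist (sum ?f Y) ?s < e" if Y: "finite Y" "hd ` F \<subseteq> Y" for Y
    proof -
      have c: "coord (sum ?f Y - ?s) \<alpha> = (if \<alpha> = [] \<or> hd \<alpha> \<in> Y then 0 else - coord y \<alpha>)" for \<alpha>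
        using Y(1)
        by (cases \<alpha>) (auto simp: coord_sum creation_apply coord_tensor_left coord_adj_creation
            coord_ket if_distrib cong: if_cong)
      \<comment> \<open>The difference lives on words outside \<open>F\<close>, and \<open>F\<close> carries all but \<open>(e / 2)\<^sup>2\<close> of \<open>\<parallel>y\<parallel>\<^sup>2\<close>.\<close>
      have "(norm (sum ?f Y - ?s))\<^sup>2 \<le> (e / 2)\<^sup>2"
        unfolding ell2_norm_sq
      proof (rule infsum_le_finite_sums[OF coord_summable])
        fix G :: "'n list set" assume "finite G"
        have "(\<Sum>\<alpha>\<in>G. (cmod (coord (sum ?f Y - ?s) \<alpha>))\<^sup>2) \<le> (\<Sum>\<alpha>\<in>G - F. (cmod (coord y \<alpha>))\<^sup>2)"
        proof (rule order_trans)
          show "(\<Sum>\<alpha>\<in>G. (cmod (coord (sum ?f Y - ?s) \<alpha>))\<^sup>2)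
              \<le> (\<Sum>\<alpha>\<in>G. if \<alpha> \<in> F then 0 else (cmod (coord y \<alpha>))\<^sup>2)"
            unfolding c by (rule sum_mono) (use Y in auto)
          show "(\<Sum>\<alpha>\<in>G. if \<alpha> \<in> F then 0 else (cmod (coord y \<alpha>))\<^sup>2)
              \<le> (\<Sum>\<alpha>\<in>G - F. (cmod (coord y \<alpha>))\<^sup>2)"
            using \<open>finite G\<close> by (subst sum.If_cases) (auto simp: Diff_eq)
        qed
        also have "\<dots> = (\<Sum>\<alpha>\<in>G \<union> F. (cmod (coord y \<alpha>))\<^sup>2) - (\<Sum>\<alpha>\<in>F. (cmod (coord y \<alpha>))\<^sup>2)"
          using \<open>finite G\<close> F sum.union_disjoint[of "G - F" F "\<lambda>\<alpha>. (cmod (coord y \<alpha>))\<^sup>2"]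
          by (simp add: Int_commute[of _ F])
        also have "\<dots> \<le> (norm y)\<^sup>2 - (\<Sum>\<alpha>\<in>F. (cmod (coord y \<alpha>))\<^sup>2)"
          using \<open>finite G\<close> F by (intro diff_right_mono ell2_finite_sum_le) auto
        also have "\<dots> \<le> (e / 2)\<^sup>2"
          using Fe by (simp add: dist_real_def)
        finally show "(\<Sum>\<alpha>\<in>G. (cmod (coord (sum ?f Y - ?s) \<alpha>))\<^sup>2) \<le> (e / 2)\<^sup>2" .
      qed
      then have "norm (sum ?f Y - ?s) \<le> e / 2"
        using \<open>e > 0\<close> by (simp add: power2_le_iff_abs_le)
      then show ?thesis using \<open>e > 0\<close> by (simp add: dist_norm)
    qed
    then show ?thesis using F by (intro exI[of _ "hd ` F"]) auto
  qed
  then show ?thesis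
    unfolding has_sum_def tendsto_iff eventually_finite_subsets_at_top by auto
qed

text \<open>
  \<open>W h\<close> lists the coordinates of \<open>h\<close> with respect to an orthonormal family indexed by words, and
  \<open>V = W\<^sup>*\<close>.
\<close>

lemma fock_isometry:
  assumes "\<not> (\<exists>B :: 'h::chilbert_space set. finite B \<and> complex_vector.span B = UNIV)"
  obtains V :: "'n::countable fock \<Rightarrow>\<^sub>L 'h::chilbert_space"
    and W :: "'h::chilbert_space \<Rightarrow>\<^sub>L 'n::countable fock"
  where "\<And>h y. cinner (W h) y = cinner h (V y)" "\<And>y. W (V y) = y"
    "\<And>c h. W (c *\<^sub>C h) = c *\<^sub>C W h" "\<And>c y. V (c *\<^sub>C y) = c *\<^sub>C V y"
    "\<And>h. norm (W h) \<le> norm h" "\<And>y. norm (V y) = norm y"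
proof -
  obtain E :: "'h set" where E: "infinite E" "cinner.orthonormal E"
    using infinite_orthonormal_set[OF assms] .
  obtain s :: "nat \<Rightarrow> 'h" where s: "inj s" "range s \<subseteq> E"
    using infinite_countable_subset[OF E(1)] by blast
  define u :: "'n list \<Rightarrow> 'h" where "u = s \<circ> to_nat"
  have "inj u" unfolding u_def using s(1) by (intro inj_compose) auto
  have u: "cinner (u \<alpha>) (u \<beta>) = (if \<alpha> = \<beta> then 1 else 0)" for \<alpha> \<beta>
  proof -
    have "u \<alpha> \<in> E" "u \<beta> \<in> E" using s(2) by (auto simp: u_def)
    then show ?thesis
      using E(2) inj_eq[OF \<open>inj u\<close>] by (simp add: cinner.orthonormal_def)
  qed
  have bessel: "(\<Sum>\<alpha>\<in>F. (cmod (cinner h (u \<alpha>)))\<^sup>2) \<le> (norm h)\<^sup>2" if "finite F" for F h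
  proof -
    have "cinner.orthonormal (u ` F)"
      using u inj_eq[OF \<open>inj u\<close>] by (auto simp: cinner.orthonormal_def)
    then have "(\<Sum>e\<in>u ` F. (cmod (cinner h e))\<^sup>2) \<le> (norm h)\<^sup>2"
      using cinner.bessel[of "u ` F" h] that by (simp add: Re_cinner power2_norm_eq_inner)
    then show ?thesis
      using \<open>inj u\<close> by (subst (asm) sum.reindex) (auto simp: inj_on_def)
  qed
  have sm: "(\<lambda>\<alpha>. (cmod (cinner h (u \<alpha>)))\<^sup>2) summable_on UNIV" for h
    using bessel[of _ h]
    by (intro nonneg_bdd_above_summable_on) (auto intro!: bdd_aboveI[where M = "(norm h)\<^sup>2"])
  define w where "w h = Abs_ell2 (\<lambda>\<alpha>. cinner h (u \<alpha>))" for h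
  have cw: "coord (w h) \<alpha> = cinner h (u \<alpha>)" for h \<alpha>
    unfolding w_def by (subst coord_Abs[OF sm]) (rule refl)
  have nw: "norm (w h) \<le> norm h" for h
  proof -
    have "(norm (w h))\<^sup>2 \<le> (norm h)\<^sup>2"
      unfolding ell2_norm_sq cw by (rule infsum_le_finite_sums[OF sm bessel])
    then show ?thesis by (simp add: power2_le_iff_abs_le)
  qed
  have "bounded_linear w"
  proof (rule bounded_linear_intro[where K = 1])
    show "w (x + y) = w x + w y" for x y
      by (rule ell2_eqI) (simp add: cw cinner_add_left)
    show "w (r *\<^sub>R x) = r *\<^sub>R w x" for r x
      by (rule ell2_eqI) (simp add: cw cinner_scaleR_left scaleR_conv_of_real)
  qed (simp add: nw)
  then have W: "blinfun_apply (Blinfun w) = w"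
    by (rule bounded_linear_Blinfun_apply)
  have Wc: "Blinfun w (c *\<^sub>C h) = c *\<^sub>C Blinfun w h" for c h
    unfolding W by (rule ell2_eqI) (simp add: cw cinner_scaleC_left)
  obtain V :: "'n fock \<Rightarrow>\<^sub>L 'h" where V: "\<And>x y. cinner (Blinfun w x) y = cinner x (V y)"
      and Vc: "\<And>c y. V (c *\<^sub>C y) = c *\<^sub>C V y"
    by (rule adjoint_exists[of "Blinfun w", OF Wc]) (rule that)
  have WV: "w (V y) = y" for y
  proof (rule ell2_eqI)
    fix \<alpha>
    have "w (u \<alpha>) = ket \<alpha>"
      by (rule ell2_eqI) (auto simp: cw u coord_ket)
    then have "cinner (u \<alpha>) (V y) = cinner (ket \<alpha>) y"
      using V[of "u \<alpha>" y] by (simp add: W)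
    then have "cinner (V y) (u \<alpha>) = cinner y (ket \<alpha>)"
      using cinner_commute[of "V y"] cinner_commute[of y] by simp
    then show "coord (w (V y)) \<alpha> = coord y \<alpha>"
      by (simp add: cw cinner_ket)
  qed
  have "norm (V y) = norm y" for y
  proof -
    have "cinner (V y) (V y) = cinner y y"
      using V[of "V y" y] by (simp add: W WV)
    then have "(norm (V y))\<^sup>2 = (norm y)\<^sup>2"
      unfolding cinner_self of_real_eq_iff .
    then show ?thesis by simp
  qed
  then show ?thesis
    using that[of "Blinfun w" V] V Vc Wc nw WV by (simp add: W)
qed

section \<open>Evaluation of free power series\<close>

text \<open>
  Unlike \<open>free_holomorphic\<close>, this speaks of a single tuple, on an arbitrary space; it is needed for
  \<open>(rS\<^sub>i)\<^sub>i\<close>.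
\<close>

definition free_convergent ::
  "('n::countable list \<Rightarrow> complex) \<Rightarrow> ('n \<Rightarrow> 'h::chilbert_space \<Rightarrow>\<^sub>L 'h) \<Rightarrow> bool" where
  "free_convergent a X \<longleftrightarrow>
     (\<forall>k. (\<lambda>\<alpha>. scalar_op (a \<alpha>) o\<^sub>L word_op X \<alpha>) summable_on {\<alpha>. length \<alpha> = k}) \<and>
     summable (homogeneous_part a X)"

lemma free_holomorphicD:
  assumes "free_holomorphic a f" "X \<in> row_ball"
  shows "free_convergent a X" "f X = free_eval a X"
  using assms sums_unique
  by (auto simp: free_holomorphic_def free_convergent_def free_eval_def sums_iff)

lemma free_eval_bounded_linear:
  assumes X: "free_convergent a X" and \<Phi>: "bounded_linear \<Phi>"
    and u: "\<And>\<alpha>. \<Phi> (scalar_op (a \<alpha>) o\<^sub>L word_op X \<alpha>) = u \<alpha>"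
  shows "u summable_on {\<alpha>. length \<alpha> = k}"
    and "(\<lambda>k. \<Sum>\<^sub>\<infinity>\<alpha>\<in>{\<alpha>. length \<alpha> = k}. u \<alpha>) sums \<Phi> (free_eval a X)"
proof -
  have s: "(\<lambda>\<alpha>. scalar_op (a \<alpha>) o\<^sub>L word_op X \<alpha>) summable_on {\<alpha>. length \<alpha> = k}" for k
    using X by (simp add: free_convergent_def)
  have h: "(u has_sum \<Phi> (homogeneous_part a X k)) {\<alpha>. length \<alpha> = k}" for k
    using has_sum_bounded_linear[OF \<Phi> has_sum_infsum[OF s[of k]]]
    by (simp add: homogeneous_part_def u o_def)
  then show "u summable_on {\<alpha>. length \<alpha> = k}"
    by (rule has_sum_imp_summable)
  have "homogeneous_part a X sums free_eval a X"
    using X by (simp add: free_convergent_def free_eval_def summable_sums)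
  then have "(\<lambda>k. \<Phi> (homogeneous_part a X k)) sums \<Phi> (free_eval a X)"
    by (rule bounded_linear.sums[OF \<Phi>])
  then show "(\<lambda>k. \<Sum>\<^sub>\<infinity>\<alpha>\<in>{\<alpha>. length \<alpha> = k}. u \<alpha>) sums \<Phi> (free_eval a X)"
    by (simp add: infsumI[OF h])
qed

text \<open>
  Identities between values of the same series are checked on monomials. The two operator tuples
  may act on different spaces.
\<close>

lemma free_eval_eqI:
  assumes "free_convergent a X" "bounded_linear \<Phi>" "free_convergent a Y" "bounded_linear \<Psi>"
    and "\<And>\<alpha>. \<Phi> (scalar_op (a \<alpha>) o\<^sub>L word_op X \<alpha>) = \<Psi> (scalar_op (a \<alpha>) o\<^sub>L word_op Y \<alpha>)"
  shows "\<Phi> (free_eval a X) = \<Psi> (free_eval a Y)"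
  using free_eval_bounded_linear(2)[OF assms(1,2,5)]
    free_eval_bounded_linear(2)[OF assms(3,4) refl]
  by (rule sums_unique2)

lemma free_eval_map:
  assumes "free_convergent a X" "bounded_linear \<Phi>"
    and "\<And>\<alpha>. \<Phi> (scalar_op (a \<alpha>) o\<^sub>L word_op X \<alpha>) = scalar_op (a \<alpha>) o\<^sub>L word_op Y \<alpha>"
  shows "free_convergent a Y" "free_eval a Y = \<Phi> (free_eval a X)"
proof -
  note * = free_eval_bounded_linear[OF assms]
  show "free_convergent a Y"
    using *(1) sums_summable[OF *(2)] by (simp add: free_convergent_def homogeneous_part_def[abs_def])
  show "free_eval a Y = \<Phi> (free_eval a X)"
    using sums_unique[OF *(2)] by (simp add: free_eval_def homogeneous_part_def)
qed

section \<open>Evaluation on the Fock space\<close>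

text \<open>
  The tuple \<open>(r V S\<^sub>i V\<^sup>*)\<^sub>i\<close> lies in the ball of the given Hilbert space; the range of \<open>V\<close> reduces
  it to a copy of \<open>(r S\<^sub>i)\<^sub>i\<close>.
\<close>

lemma fock_copy:
  assumes inf: "\<not> (\<exists>B :: 'h::chilbert_space set. finite B \<and> complex_vector.span B = UNIV)"
    and r: "0 \<le> r" "r < 1"
  obtains X :: "'n::countable \<Rightarrow> 'h::chilbert_space \<Rightarrow>\<^sub>L 'h"
    and V :: "'n::countable fock \<Rightarrow>\<^sub>L 'h::chilbert_space"
    and W :: "'h::chilbert_space \<Rightarrow>\<^sub>L 'n::countable fock"
  where "X \<in> row_ball"
    "\<And>\<alpha> y. word_op X \<alpha> (V y) = V (word_op (\<lambda>i. r *\<^sub>R creation i) \<alpha> y)"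
    "\<And>y. W (V y) = y" "\<And>c h. W (c *\<^sub>C h) = c *\<^sub>C W h" "\<And>c y. V (c *\<^sub>C y) = c *\<^sub>C V y"
    "\<And>h. norm (W h) \<le> norm h" "\<And>y. norm (V y) = norm y"
proof -
  obtain V :: "'n fock \<Rightarrow>\<^sub>L 'h" and W :: "'h \<Rightarrow>\<^sub>L 'n fock"
    where adj: "\<And>h y. cinner (W h) y = cinner h (V y)" and WV: "\<And>y. W (V y) = y"
    and Wc: "\<And>c h. W (c *\<^sub>C h) = c *\<^sub>C W h" and Vc: "\<And>c y. V (c *\<^sub>C y) = c *\<^sub>C V y"
    and nW: "\<And>h. norm (W h) \<le> norm h" and nV: "\<And>y. norm (V y) = norm y"
    by (rule fock_isometry[OF inf]) (rule that)
  define X :: "'n \<Rightarrow> 'h \<Rightarrow>\<^sub>L 'h" where "X i = r *\<^sub>R (V o\<^sub>L creation i o\<^sub>L W)" for i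
  have X_bo: "X i \<in> bounded_ops" for i
    unfolding X_def
    by (intro bounded_ops_scaleR)
      (simp add: bounded_ops_def Wc Vc bounded_opsD[OF creation_bounded_ops])
  have adj': "cinner (V y) h = cinner y (W h)" for y h
    using adj[of h y] cinner_commute[of "V y" h] cinner_commute[of y "W h"] by simp
  have X_adj: "adj (X i) = r *\<^sub>R (V o\<^sub>L adj (creation i) o\<^sub>L W)" for i
    by (rule adj_eqI) (simp add: X_def blinfun.scaleR_left cinner_scaleR_left cinner_scaleR_right
        adj' adj cinner_adj[OF creation_bounded_ops])
  define T where "T h = r\<^sup>2 *\<^sub>R V (W h - coord (W h) [] *\<^sub>C ket [])" for h
  have hs: "((\<lambda>i. X i (adj (X i) h)) has_sum T h) UNIV" for h
  proof -
    have "((\<lambda>i. V (creation i (adj (creation i) (W h)))) has_sum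
        V (W h - coord (W h) [] *\<^sub>C ket [])) UNIV"
      using has_sum_bounded_linear[OF blinfun.bounded_linear_right[of V] sum_creation_adj[of "W h"]]
      by (simp add: o_def)
    then have "((\<lambda>i. r\<^sup>2 *\<^sub>R V (creation i (adj (creation i) (W h)))) has_sum T h) UNIV"
      unfolding T_def by (rule has_sum_scaleR)
    then show ?thesis
      unfolding X_adj by (simp add: X_def blinfun.bilinear_simps WV power2_eq_square)
  qed
  have nT: "norm (T h) \<le> r\<^sup>2 * norm h" for h
  proof -
    have "(norm (W h - coord (W h) [] *\<^sub>C ket []))\<^sup>2 \<le> (norm (W h))\<^sup>2"
      using norm_diff_proj_unit[OF norm_ket, of "W h" "[]"] by (simp add: cinner_ket)
    then have "norm (W h - coord (W h) [] *\<^sub>C ket []) \<le> norm h"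
      using nW[of h] by (meson norm_ge_zero order_trans power2_le_imp_le)
    then show ?thesis
      by (simp add: T_def nV mult_left_mono)
  qed
  have "bounded_linear T"
  proof (rule bounded_linear_intro[where K = "r\<^sup>2"])
    show "T (x + y) = T x + T y" for x y
      unfolding T_def by (simp add: blinfun.bilinear_simps scaleC_add_left algebra_simps)
    show "T (c *\<^sub>R x) = c *\<^sub>R T x" for c x
    proof -
      have "(complex_of_real c * z) *\<^sub>C y = c *\<^sub>R z *\<^sub>C y" for z and y :: "'n fock"
        unfolding scaleC_scaleC[symmetric] scaleC_of_real ..
      then show ?thesis
        unfolding T_def
        by (simp add: blinfun.bilinear_simps scaleR_diff_right mult.commute[of c "r\<^sup>2"])
    qed
    show "norm (T x) \<le> norm x * r\<^sup>2" for x
      using nT[of x] by (simp add: mult.commute)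
  qed
  then have T: "blinfun_apply (Blinfun T) = T"
    by (rule bounded_linear_Blinfun_apply)
  have X_row: "X \<in> row_ops"
    unfolding row_ops_def mem_Collect_eq
    by (intro conjI allI X_bo exI[of _ "Blinfun T"]) (simp add: T hs)
  have "norm (row_square X) \<le> r\<^sup>2"
  proof (rule norm_blinfun_bound)
    show "norm (row_square X h) \<le> r\<^sup>2 * norm h" for h
      using nT[of h] has_sum_unique[OF hs row_square_apply[OF X_row]] by simp
  qed simp
  then have "row_norm X \<le> r"
    unfolding row_norm_def using r by (simp add: real_le_lsqrt)
  then have "X \<in> row_ball"
    using X_row r by (simp add: row_ball_def)
  moreover have "word_op X \<alpha> (V y) = V (word_op (\<lambda>i. r *\<^sub>R creation i) \<alpha> y)" for \<alpha> y
    by (induction \<alpha>) (simp_all add: X_def blinfun.bilinear_simps WV)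
  ultimately show ?thesis
    by (rule that) (rule WV Wc Vc nW nV)+
qed

text \<open>
  The identities hold on monomials and pass to the series by continuity. The first one says that the
  range of \<open>V\<close> is invariant under \<open>f(X)\<close>, so that the compression to it is multiplicative.
\<close>

lemma eval_fock_copy:
  fixes V :: "'n::countable fock \<Rightarrow>\<^sub>L 'h::chilbert_space" and W :: "'h \<Rightarrow>\<^sub>L 'n fock"
    and f :: "('n \<Rightarrow> 'h \<Rightarrow>\<^sub>L 'h) \<Rightarrow> ('h \<Rightarrow>\<^sub>L 'h)"
  assumes f: "free_holomorphic a f" and X: "X \<in> row_ball"
    and XV: "\<And>\<alpha> y. word_op X \<alpha> (V y) = V (word_op (\<lambda>i. r *\<^sub>R creation i) \<alpha> y)"
    and WV: "\<And>y. W (V y) = y" and Wc: "\<And>c h. W (c *\<^sub>C h) = c *\<^sub>C W h"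
    and Vc: "\<And>c y. V (c *\<^sub>C y) = c *\<^sub>C V y"
  shows "free_convergent a (\<lambda>i. r *\<^sub>R creation i)"
    and "f X (V y) = V (free_eval a (\<lambda>i. r *\<^sub>R creation i) y)"
    and "free_eval a (\<lambda>i. r *\<^sub>R creation i) y = W (f X (V y))"
proof -
  note fX = free_holomorphicD[OF f X]
  have "bounded_linear (\<lambda>A. A o\<^sub>L V)"
    by (rule bounded_bilinear.bounded_linear_left[OF bounded_bilinear_blinfun_compose])
  then have \<Phi>: "bounded_linear (\<lambda>A. W o\<^sub>L (A o\<^sub>L V))"
    by (rule bounded_linear_compose[OF bounded_bilinear.bounded_linear_right
          [OF bounded_bilinear_blinfun_compose]])
  have mono: "W o\<^sub>L ((scalar_op (a \<alpha>) o\<^sub>L word_op X \<alpha>) o\<^sub>L V)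
      = scalar_op (a \<alpha>) o\<^sub>L word_op (\<lambda>i. r *\<^sub>R creation i) \<alpha>" for \<alpha>
    by (rule blinfun_eqI) (simp add: XV Wc WV)
  show conv: "free_convergent a (\<lambda>i. r *\<^sub>R creation i)"
    by (rule free_eval_map(1)[OF fX(1) \<Phi> mono])
  show "free_eval a (\<lambda>i. r *\<^sub>R creation i) y = W (f X (V y))"
    using free_eval_map(2)[OF fX(1) \<Phi> mono] by (simp add: fX(2))
  have "free_eval a X o\<^sub>L V = V o\<^sub>L free_eval a (\<lambda>i. r *\<^sub>R creation i)"
  proof (rule free_eval_eqI[OF fX(1) _ conv])
    show "(scalar_op (a \<alpha>) o\<^sub>L word_op X \<alpha>) o\<^sub>L V
        = V o\<^sub>L (scalar_op (a \<alpha>) o\<^sub>L word_op (\<lambda>i. r *\<^sub>R creation i) \<alpha>)" for \<alpha>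
      by (rule blinfun_eqI) (simp add: XV Vc)
  qed (rule bounded_bilinear.bounded_linear_left bounded_bilinear.bounded_linear_right,
      rule bounded_bilinear_blinfun_compose)+
  then show "f X (V y) = V (free_eval a (\<lambda>i. r *\<^sub>R creation i) y)"
    by (metis fX(2) blinfun_apply_blinfun_compose)
qed

lemma free_eval_bounded_ops:
  assumes conv: "free_convergent a X" and X: "\<And>i. X i \<in> bounded_ops"
  shows "free_eval a X \<in> bounded_ops"
proof -
  have "free_eval a X o\<^sub>L scalar_op c = scalar_op c o\<^sub>L free_eval a X" for c
  proof (rule free_eval_eqI[OF conv _ conv])
    show "(scalar_op (a \<alpha>) o\<^sub>L word_op X \<alpha>) o\<^sub>L scalar_op c
        = scalar_op c o\<^sub>L (scalar_op (a \<alpha>) o\<^sub>L word_op X \<alpha>)" for \<alpha>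
      by (rule blinfun_eqI)
        (simp add: bounded_opsD[OF word_op_bounded_ops[OF X]] scaleC_scaleC mult.commute)
  qed (rule bounded_bilinear.bounded_linear_left bounded_bilinear.bounded_linear_right,
      rule bounded_bilinear_blinfun_compose)+
  from arg_cong[OF this, of blinfun_apply] show ?thesis
    by (simp add: bounded_ops_def fun_eq_iff)
qed

lemma coord_free_eval_creation:
  assumes conv: "free_convergent a (\<lambda>i. r *\<^sub>R creation i)"
  shows "coord (free_eval a (\<lambda>i. r *\<^sub>R creation i) (ket [])) \<alpha> = a \<alpha> * complex_of_real (r ^ length \<alpha>)"
proof -
  let ?\<Phi> = "\<lambda>A :: 'a fock \<Rightarrow>\<^sub>L 'a fock. cinner (A (ket [])) (ket \<alpha>)"
  define u where "u \<beta> = (if \<beta> = \<alpha> then a \<alpha> * complex_of_real (r ^ length \<alpha>) else 0)" for \<beta>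
  have bl: "bounded_linear ?\<Phi>"
    by (intro bounded_linear_compose[OF bounded_linear_cinner_left] blinfun.bounded_linear_left)
  have u: "?\<Phi> (scalar_op (a \<beta>) o\<^sub>L word_op (\<lambda>i. r *\<^sub>R creation i) \<beta>) = u \<beta>" for \<beta>
    by (simp add: word_op_scaleR word_op_creation_ket cinner_ket blinfun.bilinear_simps coord_ket u_def)
  have "(\<Sum>\<^sub>\<infinity>\<beta>\<in>{\<beta>. length \<beta> = k}. u \<beta>)
      = (if k = length \<alpha> then a \<alpha> * complex_of_real (r ^ length \<alpha>) else 0)" for k
  proof (cases "k = length \<alpha>")
    case True
    then have "(\<Sum>\<^sub>\<infinity>\<beta>\<in>{\<beta>. length \<beta> = k}. u \<beta>) = (\<Sum>\<^sub>\<infinity>\<beta>\<in>{\<alpha>}. u \<beta>)"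
      by (intro infsum_cong_neutral) (auto simp: u_def)
    with True show ?thesis by (simp add: u_def)
  next
    case False
    then have "(\<Sum>\<^sub>\<infinity>\<beta>\<in>{\<beta>. length \<beta> = k}. u \<beta>) = 0"
      by (intro infsum_0) (auto simp: u_def)
    with False show ?thesis by simp
  qed
  with free_eval_bounded_linear(2)[OF conv bl u]
  have "(\<lambda>k. if k = length \<alpha> then a \<alpha> * complex_of_real (r ^ length \<alpha>) else 0)
      sums ?\<Phi> (free_eval a (\<lambda>i. r *\<^sub>R creation i))"
    by simp
  moreover have "(\<lambda>k. if k = length \<alpha> then a \<alpha> * complex_of_real (r ^ length \<alpha>) else 0)
      sums (a \<alpha> * complex_of_real (r ^ length \<alpha>))"
    by (rule sums_single)
  ultimately show ?thesis
    using sums_unique2 by (simp add: cinner_ket)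
qed

section \<open>The Poisson kernel\<close>

lemma row_ball_scaleR:
  fixes X :: "'n::countable \<Rightarrow> 'h::chilbert_space \<Rightarrow>\<^sub>L 'h"
  assumes X: "X \<in> row_ops" and "row_norm X < r"
  shows "(\<lambda>i. (1 / r) *\<^sub>R X i) \<in> row_ball"
proof -
  have "r > 0"
    using assms(2) real_sqrt_ge_zero[OF norm_ge_zero] unfolding row_norm_def
    by (rule le_less_trans[rotated])
  let ?Y = "\<lambda>i. (1 / r) *\<^sub>R X i"
  have bo: "X i \<in> bounded_ops" for i using X by (simp add: row_ops_def)
  have hs: "((\<lambda>i. ?Y i (adj (?Y i) h)) has_sum ((1 / r)\<^sup>2 *\<^sub>R row_square X) h) UNIV" for h
    using has_sum_scaleR[OF row_square_apply[OF X, of h], of "(1 / r)\<^sup>2"]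
    by (simp add: adj_scaleR[OF bo] blinfun.bilinear_simps power2_eq_square)
  have Y: "?Y \<in> row_ops"
    unfolding row_ops_def mem_Collect_eq using hs bo by (blast intro: bounded_ops_scaleR)
  have "row_square ?Y = (1 / r)\<^sup>2 *\<^sub>R row_square X"
    by (rule blinfun_eqI) (rule has_sum_unique[OF row_square_apply[OF Y] hs])
  then have "row_norm ?Y = row_norm X / r"
    using \<open>r > 0\<close> by (simp add: row_norm_def real_sqrt_mult real_sqrt_divide)
  then show ?thesis
    using Y \<open>r > 0\<close> assms(2) by (simp add: row_ball_def)
qed

text \<open>
  The form \<open>\<langle>\<Delta>x, y\<rangle>\<close> of the defect operator \<open>\<Delta> = 1 - \<Sum>\<^sub>i Y\<^sub>i Y\<^sub>i\<^sup>*\<close>.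
\<close>

definition defect_form ::
  "('n::countable \<Rightarrow> 'h::chilbert_space \<Rightarrow>\<^sub>L 'h) \<Rightarrow> 'h \<Rightarrow> 'h \<Rightarrow> complex" where
  "defect_form Y x y = cinner x y - cinner (row_square Y x) y"

context
  fixes Y :: "'n::countable \<Rightarrow> 'h::chilbert_space \<Rightarrow>\<^sub>L 'h"
  assumes Y: "Y \<in> row_ball"
begin

lemma row_ball_bounded_ops: "Y i \<in> bounded_ops"
  using Y by (simp add: row_ball_def row_ops_def)

lemma row_ball_norm_less: "norm (row_square Y) < 1"
  using Y by (simp add: row_ball_def row_norm_def)

lemma cinner_row_square:
  "((\<lambda>i. cinner (adj (Y i) x) (adj (Y i) y)) has_sum cinner (row_square Y x) y) UNIV"
proof -
  have "Y \<in> row_ops" using Y by (simp add: row_ball_def)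
  from has_sum_bounded_linear[OF bounded_linear_cinner_left row_square_apply[OF this, of x], of y]
  show ?thesis by (simp add: o_def cinner_adj[OF row_ball_bounded_ops])
qed

lemma norm_adj_row:
  "((\<lambda>i. (norm (adj (Y i) x))\<^sup>2) has_sum inner (row_square Y x) x) UNIV"
  using has_sum_Re[OF cinner_row_square[of x x]]
  by (simp add: Re_cinner power2_norm_eq_inner)

lemma row_square_le: "inner (row_square Y x) x \<le> norm (row_square Y) * (norm x)\<^sup>2"
proof -
  have "inner (row_square Y x) x \<le> norm (row_square Y x) * norm x"
    by (rule norm_cauchy_schwarz)
  also have "\<dots> \<le> (norm (row_square Y) * norm x) * norm x"
    by (intro mult_right_mono norm_blinfun) simp
  finally show ?thesis by (simp add: power2_eq_square)
qed

lemma Re_defect_form: "Re (defect_form Y x x) = (norm x)\<^sup>2 - inner (row_square Y x) x"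
  by (simp add: defect_form_def Re_cinner power2_norm_eq_inner)

lemma defect_form_lower: "(1 - norm (row_square Y)) * (norm x)\<^sup>2 \<le> Re (defect_form Y x x)"
  using row_square_le[of x] by (simp add: Re_defect_form algebra_simps)

lemma positive_form_defect: "positive_form (defect_form Y)"
proof
  fix x y z :: 'h and c
  show "defect_form Y (x + y) z = defect_form Y x z + defect_form Y y z"
    by (simp add: defect_form_def blinfun.add_right cinner_add_left)
  have "((\<lambda>i. cinner (adj (Y i) (c *\<^sub>C x)) (adj (Y i) y)) has_sum (c * cinner (row_square Y x) y)) UNIV"
    using has_sum_cmult_right[OF cinner_row_square[of x y], of c]
    by (simp add: bounded_opsD[OF adj_bounded_ops[OF row_ball_bounded_ops]] cinner_scaleC_left)
  then have "cinner (row_square Y (c *\<^sub>C x)) y = c * cinner (row_square Y x) y"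
    by (rule has_sum_unique[OF cinner_row_square])
  then show "defect_form Y (c *\<^sub>C x) y = c * defect_form Y x y"
    by (simp add: defect_form_def cinner_scaleC_left algebra_simps)
  have "((\<lambda>i. cnj (cinner (adj (Y i) y) (adj (Y i) x))) has_sum cnj (cinner (row_square Y y) x)) UNIV"
    unfolding has_sum_cnj_iff by (rule cinner_row_square)
  then have "((\<lambda>i. cinner (adj (Y i) x) (adj (Y i) y)) has_sum cnj (cinner (row_square Y y) x)) UNIV"
    unfolding cinner_commute[symmetric] .
  then have "cinner (row_square Y x) y = cnj (cinner (row_square Y y) x)"
    by (rule has_sum_unique[OF cinner_row_square])
  then show "defect_form Y x y = cnj (defect_form Y y x)"
    using cinner_commute[of x y] by (simp add: defect_form_def)
  assume "x \<noteq> 0"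
  then have "0 < (1 - norm (row_square Y)) * (norm x)\<^sup>2"
    using row_ball_norm_less by simp
  then show "0 < Re (defect_form Y x x)"
    using defect_form_lower[of x] by linarith
qed

text \<open>
  The squared norm of the component at \<open>\<alpha>\<close> of the Poisson kernel applied to \<open>x\<close>.
\<close>

definition defect :: "'n list \<Rightarrow> 'h \<Rightarrow> real" where
  "defect \<alpha> x = Re (defect_form Y (adj (word_op Y \<alpha>) x) (adj (word_op Y \<alpha>) x))"

lemma defect_nonneg: "0 \<le> defect \<alpha> x"
  unfolding defect_def using row_ball_norm_less
  by (intro order_trans[OF _ defect_form_lower]) simp

lemma word_bounded_ops: "word_op Y \<alpha> \<in> bounded_ops"
  by (intro word_op_bounded_ops row_ball_bounded_ops)

lemma defect_Cons: "defect (i # \<alpha>) x = defect \<alpha> (adj (Y i) x)"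
  by (simp add: defect_def adj_compose[OF row_ball_bounded_ops word_bounded_ops])

text \<open>
  The words shorter than \<open>k + 1\<close> are the empty word and the words \<open>i\<alpha>\<close> with \<open>\<alpha>\<close> shorter than \<open>k\<close>;
  with \<open>q = \<parallel>\<Sum>\<^sub>i Y\<^sub>i Y\<^sub>i\<^sup>*\<parallel>\<close> the bounds propagate because the empty word contributes
  \<open>\<parallel>x\<parallel>\<^sup>2 - \<Sum>\<^sub>i \<parallel>Y\<^sub>i\<^sup>* x\<parallel>\<^sup>2\<close>.
\<close>

lemma defect_partial_sum:
  "\<exists>t. ((\<lambda>\<alpha>. defect \<alpha> x) has_sum t) {\<alpha>. length \<alpha> < k} \<and>
     (1 - norm (row_square Y) ^ k) * (norm x)\<^sup>2 \<le> t \<and> t \<le> (norm x)\<^sup>2"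
proof (induction k arbitrary: x)
  case 0
  show ?case by (intro exI[of _ 0]) simp
next
  case (Suc k)
  define q where "q = norm (row_square Y)"
  have "0 \<le> q" by (simp add: q_def)
  define s where "s = inner (row_square Y x) x"
  have s: "((\<lambda>i. (norm (adj (Y i) x))\<^sup>2) has_sum s) UNIV"
    unfolding s_def by (rule norm_adj_row)
  have "\<forall>i. \<exists>t. ((\<lambda>\<alpha>. defect \<alpha> (adj (Y i) x)) has_sum t) {\<alpha>. length \<alpha> < k} \<and>
      (1 - q ^ k) * (norm (adj (Y i) x))\<^sup>2 \<le> t \<and> t \<le> (norm (adj (Y i) x))\<^sup>2"
    unfolding q_def by (intro allI Suc.IH)
  from choice[OF this] obtain t
    where t: "\<And>i. ((\<lambda>\<alpha>. defect \<alpha> (adj (Y i) x)) has_sum t i) {\<alpha>. length \<alpha> < k}"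
    and lo: "\<And>i. (1 - q ^ k) * (norm (adj (Y i) x))\<^sup>2 \<le> t i"
    and up: "\<And>i. t i \<le> (norm (adj (Y i) x))\<^sup>2"
    by auto
  have t_nonneg: "0 \<le> t i" for i
    by (rule has_sum_nonneg[OF t]) (rule defect_nonneg)
  have t_sm: "t summable_on UNIV"
    by (rule summable_on_comparison_test[OF has_sum_imp_summable[OF s] up]) (rule t_nonneg)
  define S where "S = (\<Sum>\<^sub>\<infinity>i. t i)"
  have S: "(t has_sum S) UNIV"
    unfolding S_def by (rule has_sum_infsum[OF t_sm])
  have S_up: "S \<le> s"
    by (rule has_sum_mono[OF S s up])
  have S_lo: "(1 - q ^ k) * s \<le> S"
    by (rule has_sum_mono[OF has_sum_cmult_right[OF s] S lo])
  let ?g = "\<lambda>(i, \<alpha>). defect \<alpha> (adj (Y i) x)"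
  have "?g summable_on (SIGMA i:UNIV. {\<alpha>. length \<alpha> < k})"
    by (rule summable_on_SigmaI[where g = t]) (use t t_sm defect_nonneg in auto)
  then have "(?g has_sum S) (SIGMA i:UNIV. {\<alpha>. length \<alpha> < k})"
    by (intro has_sum_SigmaI[where g = t]) (use t S in auto)
  then have "(((\<lambda>\<beta>. defect \<beta> x) \<circ> (\<lambda>(i, \<alpha>). i # \<alpha>)) has_sum S) (SIGMA i:UNIV. {\<alpha>. length \<alpha> < k})"
    by (rule has_sum_cong[THEN iffD1, rotated]) (auto simp: defect_Cons)
  then have "((\<lambda>\<beta>. defect \<beta> x) has_sum S) ((\<lambda>(i, \<alpha>). i # \<alpha>) ` (SIGMA i:UNIV. {\<alpha>. length \<alpha> < k}))"
    by (subst has_sum_reindex) (auto simp: inj_on_def)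
  moreover have "((\<lambda>\<beta>. defect \<beta> x) has_sum defect [] x) {[]}"
    by (rule has_sum_finiteI) auto
  ultimately have "((\<lambda>\<beta>. defect \<beta> x) has_sum (defect [] x + S))
      ({[]} \<union> (\<lambda>(i, \<alpha>). i # \<alpha>) ` (SIGMA i:UNIV. {\<alpha>. length \<alpha> < k}))"
    by (intro has_sum_Un_disjoint) auto
  moreover have "{[]} \<union> (\<lambda>(i, \<alpha>). i # \<alpha>) ` (SIGMA i:UNIV. {\<alpha>. length \<alpha> < k})
      = {\<beta> :: 'n list. length \<beta> < Suc k}"
  proof (intro equalityI subsetI)
    fix \<beta> :: "'n list" assume "\<beta> \<in> {\<beta>. length \<beta> < Suc k}"
    then show "\<beta> \<in> {[]} \<union> (\<lambda>(i, \<alpha>). i # \<alpha>) ` (SIGMA i:UNIV. {\<alpha>. length \<alpha> < k})"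
      by (cases \<beta>) auto
  qed auto
  ultimately have "((\<lambda>\<beta>. defect \<beta> x) has_sum (defect [] x + S)) {\<beta>. length \<beta> < Suc k}"
    by simp
  moreover have d: "defect [] x = (norm x)\<^sup>2 - s"
    by (simp add: defect_def adj_id Re_defect_form s_def)
  moreover have "(1 - q ^ Suc k) * (norm x)\<^sup>2 \<le> (norm x)\<^sup>2 - s + S"
  proof -
    have "q ^ k * s \<le> q ^ k * (q * (norm x)\<^sup>2)"
      using row_square_le[of x] \<open>0 \<le> q\<close> by (intro mult_left_mono) (simp_all add: s_def q_def)
    then show ?thesis using S_lo by (simp add: algebra_simps)
  qed
  ultimately show ?case
    using S_up unfolding q_def by (intro exI[of _ "defect [] x + S"]) simp
qed

text \<open>
  The Poisson kernel is isometric: the lower bound of the partial sums tends to \<open>\<parallel>x\<parallel>\<^sup>2\<close> because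
  \<open>\<parallel>\<Sum>\<^sub>i Y\<^sub>i Y\<^sub>i\<^sup>*\<parallel> < 1\<close>.
\<close>

lemma defect_sum: "((\<lambda>\<alpha>. defect \<alpha> x) has_sum (norm x)\<^sup>2) UNIV"
proof -
  have up: "(\<Sum>\<alpha>\<in>F. defect \<alpha> x) \<le> (norm x)\<^sup>2" if "finite F" for F
  proof -
    define k where "k = Suc (Max (length ` F))"
    have F: "F \<subseteq> {\<alpha>. length \<alpha> < k}"
      using that by (auto simp: k_def less_Suc_eq_le)
    obtain t where t: "((\<lambda>\<alpha>. defect \<alpha> x) has_sum t) {\<alpha>. length \<alpha> < k}" "t \<le> (norm x)\<^sup>2"
      using defect_partial_sum[of x k] by auto
    have "(\<Sum>\<alpha>\<in>F. defect \<alpha> x) \<le> t"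
      by (rule finite_sum_le_has_sum[OF t(1) that F]) (rule defect_nonneg)
    then show ?thesis using t(2) by simp
  qed
  have sm: "(\<lambda>\<alpha>. defect \<alpha> x) summable_on UNIV"
    by (intro nonneg_bdd_above_summable_on defect_nonneg)
      (auto intro!: bdd_aboveI[where M = "(norm x)\<^sup>2"] up)
  have "(\<Sum>\<^sub>\<infinity>\<alpha>. defect \<alpha> x) = (norm x)\<^sup>2"
  proof (rule antisym)
    show "(\<Sum>\<^sub>\<infinity>\<alpha>. defect \<alpha> x) \<le> (norm x)\<^sup>2"
      by (rule infsum_le_finite_sums[OF sm up])
    have "(1 - norm (row_square Y) ^ k) * (norm x)\<^sup>2 \<le> (\<Sum>\<^sub>\<infinity>\<alpha>. defect \<alpha> x)" for k
    proof -
      obtain t where t: "((\<lambda>\<alpha>. defect \<alpha> x) has_sum t) {\<alpha>. length \<alpha> < k}"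
        "(1 - norm (row_square Y) ^ k) * (norm x)\<^sup>2 \<le> t"
        using defect_partial_sum[of x k] by auto
      have "t \<le> (\<Sum>\<^sub>\<infinity>\<alpha>. defect \<alpha> x)"
        by (rule has_sum_mono2[OF t(1) has_sum_infsum[OF sm]]) (auto simp: defect_nonneg)
      with t(2) show ?thesis by simp
    qed
    moreover have "(\<lambda>k. (1 - norm (row_square Y) ^ k) * (norm x)\<^sup>2) \<longlonglongrightarrow> (1 - 0) * (norm x)\<^sup>2"
      using row_ball_norm_less by (intro tendsto_intros LIMSEQ_power_zero) simp
    ultimately have "(1 - 0) * (norm x)\<^sup>2 \<le> (\<Sum>\<^sub>\<infinity>\<alpha>. defect \<alpha> x)"
      by (intro LIMSEQ_le_const2) auto
    then show "(norm x)\<^sup>2 \<le> (\<Sum>\<^sub>\<infinity>\<alpha>. defect \<alpha> x)" by simp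
  qed
  then show ?thesis using has_sum_infsum[OF sm] by simp
qed

end

lemma word_op_append: "word_op X (\<beta> @ \<alpha>) v = word_op X \<beta> (word_op X \<alpha> v)"
  by (induction \<beta>) simp_all

lemma has_sum_finite_sum:
  fixes f :: "'i \<Rightarrow> 'a \<Rightarrow> 'b::topological_comm_monoid_add"
  assumes "finite I" "\<And>i. i \<in> I \<Longrightarrow> (f i has_sum s i) A"
  shows "((\<lambda>x. \<Sum>i\<in>I. f i x) has_sum (\<Sum>i\<in>I. s i)) A"
  using assms by (induction I rule: finite_induct) (auto intro: has_sum_add)

text \<open>
  Let \<open>\<Pi>\<close> be the Poisson kernel, with values in the Fock space tensored with the given space. It
  satisfies \<open>\<Pi> G\<^sup>* = (T\<^sup>* \<otimes> 1) \<Pi>\<close>, because \<open>Y\<^sub>\<alpha>\<^sup>* Y\<^sub>\<beta>\<^sup>* = Y\<^bsub>\<beta>\<alpha>\<^esub>\<^sup>*\<close> and \<open>S\<^sub>\<beta> e\<^sub>\<alpha> = e\<^bsub>\<beta>\<alpha>\<^esub>\<close>. The conclusion is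
  the hypothesis for \<open>T\<^sup>* \<otimes> 1\<close> at \<open>\<Pi> x\<close>.

  The tensor product is resolved into components: for \<open>e\<close> in an orthonormal set \<open>E\<close> of the defect
  form, \<open>p e = (\<langle>\<Delta> Y\<^sub>\<alpha>\<^sup>* x, e\<rangle>)\<^sub>\<alpha>\<close> is a vector of the scalar Fock space, to which the hypothesis
  applies, and the inequalities are added up over \<open>E\<close>. On the right Bessel's inequality suffices; on
  the left Parseval's identity is needed, but if the norm of \<open>\<Pi> G\<^sup>* x\<close> is first cut down to a finite
  set \<open>F\<close> of words, only for finitely many vectors, and \<open>E\<close> can be chosen finite.
\<close>

lemma poisson_transfer:
  fixes Y :: "'n::countable \<Rightarrow> 'h::chilbert_space \<Rightarrow>\<^sub>L 'h"
  assumes Y: "Y \<in> row_ball"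
    and convY: "free_convergent a (\<lambda>i. r *\<^sub>R Y i)"
    and convS: "free_convergent a (\<lambda>i. r *\<^sub>R creation i)"
    and "0 \<le> M"
  defines "T \<equiv> free_eval a (\<lambda>i. r *\<^sub>R creation i)"
    and "G \<equiv> free_eval a (\<lambda>i. r *\<^sub>R Y i)"
  assumes ineq: "\<And>y. c * (cmod (coord (y - z *\<^sub>C adj T y) []))\<^sup>2 + (norm (adj T y))\<^sup>2 \<le> M * (norm y)\<^sup>2"
  shows "c * Re (defect_form Y (x - z *\<^sub>C adj G x) (x - z *\<^sub>C adj G x)) + (norm (adj G x))\<^sup>2
    \<le> M * (norm x)\<^sup>2"
proof -
  interpret D: positive_form "defect_form Y"
    by (rule positive_form_defect[OF Y])
  have Y_bo: "word_op Y \<alpha> \<in> bounded_ops" for \<alpha>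
    by (rule word_bounded_ops[OF Y])
  have T_bo: "T \<in> bounded_ops"
    unfolding T_def by (intro free_eval_bounded_ops convS bounded_ops_scaleR creation_bounded_ops)
  have G_bo: "G \<in> bounded_ops"
    unfolding G_def by (intro free_eval_bounded_ops convY bounded_ops_scaleR row_ball_bounded_ops Y)
  define v where "v = x - z *\<^sub>C adj G x"
  define d where "d e = e - row_square Y e" for e
  have d: "defect_form Y u e = cinner u (d e)" for u e
  proof -
    have "defect_form Y u e = cnj (cinner e u - cinner (row_square Y e) u)"
      using D.sym[of u e] by (simp add: defect_form_def)
    also have "\<dots> = cinner u e - cinner u (row_square Y e)"
      using cinner_commute[of u e] cinner_commute[of u "row_square Y e"] by simp
    finally show ?thesis by (simp add: d_def cinner_diff_right)
  qed
  define p where "p e = Abs_ell2 (\<lambda>\<alpha>. defect_form Y (adj (word_op Y \<alpha>) x) e)" for e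
  have main: "c * Re (defect_form Y v v) + (\<Sum>\<alpha>\<in>F. defect Y \<alpha> (adj G x)) \<le> M * (norm x)\<^sup>2"
    if "finite F" for F
  proof -
    have "finite (insert v ((\<lambda>\<alpha>. adj (word_op Y \<alpha>) (adj G x)) ` F))"
      using that by simp
    then obtain E where E: "finite E" "D.orthonormal E"
      and pars: "\<And>u. u \<in> insert v ((\<lambda>\<alpha>. adj (word_op Y \<alpha>) (adj G x)) ` F) \<Longrightarrow>
        (\<Sum>e\<in>E. (cmod (defect_form Y u e))\<^sup>2) = Re (defect_form Y u u)"
      by (rule D.gram_schmidt) (rule that)
    have bes: "(\<Sum>e\<in>E. (cmod (defect_form Y (adj (word_op Y \<alpha>) x) e))\<^sup>2) \<le> defect Y \<alpha> x" for \<alpha>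
      unfolding defect_def[OF Y] by (rule D.bessel[OF E])
    have sm: "(\<lambda>\<alpha>. (cmod (defect_form Y (adj (word_op Y \<alpha>) x) e))\<^sup>2) summable_on UNIV"
      if "e \<in> E" for e
    proof (rule summable_on_comparison_test[OF has_sum_imp_summable[OF defect_sum[OF Y]]])
      fix \<alpha>
      have "(cmod (defect_form Y (adj (word_op Y \<alpha>) x) e))\<^sup>2
          \<le> (\<Sum>e\<in>E. (cmod (defect_form Y (adj (word_op Y \<alpha>) x) e))\<^sup>2)"
        by (rule member_le_sum[OF that]) (use E in auto)
      also have "\<dots> \<le> defect Y \<alpha> x" by (rule bes)
      finally show "(cmod (defect_form Y (adj (word_op Y \<alpha>) x) e))\<^sup>2 \<le> defect Y \<alpha> x" .
    qed simp
    have cp: "coord (p e) \<alpha> = defect_form Y (adj (word_op Y \<alpha>) x) e" if "e \<in> E" for e \<alpha>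
      unfolding p_def by (subst coord_Abs[OF sm[OF that]]) (rule refl)
    \<comment> \<open>The intertwining relation at \<open>\<alpha>\<close>, tested against \<open>e\<close>.\<close>
    have Tp: "coord (adj T (p e)) \<alpha> = defect_form Y (adj (word_op Y \<alpha>) (adj G x)) e"
      if "e \<in> E" for e \<alpha>
    proof -
      have "cinner (p e) (T (ket \<alpha>)) = cinner x (G (word_op Y \<alpha> (d e)))"
        unfolding T_def G_def
      proof (rule free_eval_eqI[OF convS _ convY])
        show "bounded_linear (\<lambda>A. cinner (p e) (blinfun_apply A (ket \<alpha>)))"
          by (intro bounded_linear_compose[OF bounded_linear_cinner_right] blinfun.bounded_linear_left)
        show "bounded_linear (\<lambda>A. cinner x (blinfun_apply A (word_op Y \<alpha> (d e))))"
          by (intro bounded_linear_compose[OF bounded_linear_cinner_right] blinfun.bounded_linear_left)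
        fix \<beta>
        have "cinner (p e) (ket (\<beta> @ \<alpha>)) = cinner x (word_op Y \<beta> (word_op Y \<alpha> (d e)))"
          by (simp add: cinner_ket cp[OF \<open>e \<in> E\<close>] d cinner_adj'[OF Y_bo] word_op_append)
        then show "cinner (p e) ((scalar_op (a \<beta>) o\<^sub>L word_op (\<lambda>i. r *\<^sub>R creation i) \<beta>) (ket \<alpha>))
            = cinner x ((scalar_op (a \<beta>) o\<^sub>L word_op (\<lambda>i. r *\<^sub>R Y i) \<beta>) (word_op Y \<alpha> (d e)))"
          by (simp add: word_op_scaleR word_op_creation_ket blinfun.bilinear_simps
              cinner_scaleC_right cinner_scaleR_right)
      qed
      then show ?thesis
        by (simp add: cinner_ket[symmetric] cinner_adj'[OF T_bo] d cinner_adj'[OF Y_bo]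
            cinner_adj'[OF G_bo])
    qed
    have vac: "coord (p e - z *\<^sub>C adj T (p e)) [] = defect_form Y v e" if "e \<in> E" for e
      by (simp add: v_def cp[OF that] Tp[OF that] adj_id D.diff_left D.scale_left)
    have "((\<lambda>\<alpha>. \<Sum>e\<in>E. (cmod (coord (p e) \<alpha>))\<^sup>2) has_sum (\<Sum>e\<in>E. (norm (p e))\<^sup>2)) UNIV"
      unfolding ell2_norm_sq
      by (intro has_sum_finite_sum E has_sum_infsum coord_summable)
    then have np: "(\<Sum>e\<in>E. (norm (p e))\<^sup>2) \<le> (norm x)\<^sup>2"
      by (rule has_sum_mono[OF _ defect_sum[OF Y]]) (use bes cp in simp)
    have "c * Re (defect_form Y v v) + (\<Sum>\<alpha>\<in>F. defect Y \<alpha> (adj G x))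
        = c * (\<Sum>e\<in>E. (cmod (defect_form Y v e))\<^sup>2)
          + (\<Sum>\<alpha>\<in>F. \<Sum>e\<in>E. (cmod (defect_form Y (adj (word_op Y \<alpha>) (adj G x)) e))\<^sup>2)"
      using pars by (simp add: defect_def[OF Y])
    also have "\<dots> = (\<Sum>e\<in>E. c * (cmod (coord (p e - z *\<^sub>C adj T (p e)) []))\<^sup>2
        + (\<Sum>\<alpha>\<in>F. (cmod (coord (adj T (p e)) \<alpha>))\<^sup>2))"
      by (subst sum.swap) (simp add: sum.distrib sum_distrib_left vac Tp del: coord_diff coord_scaleC)
    also have "\<dots> \<le> (\<Sum>e\<in>E. M * (norm (p e))\<^sup>2)"
    proof (rule sum_mono)
      fix e assume "e \<in> E"
      have "(\<Sum>\<alpha>\<in>F. (cmod (coord (adj T (p e)) \<alpha>))\<^sup>2) \<le> (norm (adj T (p e)))\<^sup>2"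
        by (rule ell2_finite_sum_le[OF \<open>finite F\<close>])
      then show "c * (cmod (coord (p e - z *\<^sub>C adj T (p e)) []))\<^sup>2
          + (\<Sum>\<alpha>\<in>F. (cmod (coord (adj T (p e)) \<alpha>))\<^sup>2) \<le> M * (norm (p e))\<^sup>2"
        using ineq[of "p e"] by linarith
    qed
    also have "\<dots> \<le> M * (norm x)\<^sup>2"
      unfolding sum_distrib_left[symmetric] by (rule mult_left_mono[OF np \<open>0 \<le> M\<close>])
    finally show ?thesis .
  qed
  have "(norm (adj G x))\<^sup>2 \<le> M * (norm x)\<^sup>2 - c * Re (defect_form Y v v)"
    by (rule has_sum_le_finite_sums[OF defect_sum[OF Y]]) (use main in \<open>simp add: algebra_simps\<close>)
  then show ?thesis by (simp add: v_def)
qed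

section \<open>Schwarz--Pick estimate\<close>

lemma moebius_norm_identity:
  fixes u v :: "'a::chilbert_space"
  shows "(norm (u - a *\<^sub>C v))\<^sup>2 - (norm (v - cnj a *\<^sub>C u))\<^sup>2
    = (1 - (cmod a)\<^sup>2) * ((norm u)\<^sup>2 - (norm v)\<^sup>2)"
proof -
  have "inner u (a *\<^sub>C v) = inner v (cnj a *\<^sub>C u)"
    unfolding inner_commute[of v "cnj a *\<^sub>C u"] unfolding Re_cinner[symmetric]
    by (simp add: cinner_scaleC_left cinner_scaleC_right)
  then have "(norm (u - a *\<^sub>C v))\<^sup>2 - (norm (v - cnj a *\<^sub>C u))\<^sup>2
      = (norm u)\<^sup>2 + (norm (a *\<^sub>C v))\<^sup>2 - (norm v)\<^sup>2 - (norm (cnj a *\<^sub>C u))\<^sup>2"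
    unfolding power2_norm_eq_inner by (simp add: inner_simps inner_commute)
  then show ?thesis
    by (simp add: norm_scaleC power_mult_distrib algebra_simps)
qed

text \<open>
  This is Schwarz--Pick in disguise. The Moebius transform
  \<open>(R - cnj a) (1 - a R)\<^bsup>-1\<^esup>\<close> is a contraction annihilating \<open>e\<close>, so its value at \<open>v = (1 - a R) y\<close> has
  norm at most that of the component of \<open>v\<close> orthogonal to \<open>e\<close>.
\<close>

lemma contraction_eigenvector:
  fixes R :: "'a::chilbert_space \<Rightarrow>\<^sub>L 'a"
  assumes R: "R \<in> bounded_ops" "\<And>y. norm (R y) \<le> norm y"
    and e: "norm e = 1" "R e = cnj a *\<^sub>C e" and a: "cmod a < 1"
  shows "(cmod (cinner (y - a *\<^sub>C R y) e))\<^sup>2 + (1 - (cmod a)\<^sup>2) * (norm (R y))\<^sup>2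
    \<le> (1 - (cmod a)\<^sup>2) * (norm y)\<^sup>2"
proof -
  define v where "v = y - a *\<^sub>C R y"
  define t where "t = cinner v e"
  define k where "k = 1 - complex_of_real ((cmod a)\<^sup>2)"
  have a2: "(cmod a)\<^sup>2 < 1"
    using a by (simp add: power_less_one_iff abs_square_less_1)
  then have "k \<noteq> 0"
    unfolding k_def by (metis less_irrefl of_real_eq_1_iff right_minus_eq)
  have k: "k = 1 - a * cnj a" unfolding k_def complex_norm_square ..
  \<comment> \<open>\<open>w\<close> is the preimage under \<open>1 - a R\<close> of \<open>v\<close> without its \<open>e\<close>-component, as \<open>(1 - a R) e = k e\<close>;
    it stands in for the inverse applied to that vector.\<close>
  define w where "w = y - (t / k) *\<^sub>C e"
  have Rw: "R w = R y - ((t / k) * cnj a) *\<^sub>C e"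
    by (simp add: w_def blinfun.bilinear_simps bounded_opsD[OF R(1)] e scaleC_scaleC)
  have 1: "R w - cnj a *\<^sub>C w = R y - cnj a *\<^sub>C y"
    unfolding Rw unfolding w_def
    by (simp add: complex_vector.scale_right_diff_distrib scaleC_scaleC mult.commute)
  have "t / k - a * ((t / k) * cnj a) = t"
  proof -
    have "s - a * (s * cnj a) = s * k" for s
      unfolding k by (simp add: algebra_simps)
    also have "(t / k) * k = t" using \<open>k \<noteq> 0\<close> by simp
    finally show ?thesis .
  qed
  then have "v - t *\<^sub>C e = v - ((t / k) *\<^sub>C e - a *\<^sub>C ((t / k) * cnj a) *\<^sub>C e)"
    by (simp add: scaleC_scaleC complex_vector.scale_left_diff_distrib[symmetric])
  then have 2: "w - a *\<^sub>C R w = v - t *\<^sub>C e"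
    unfolding Rw unfolding w_def v_def
    by (simp add: complex_vector.scale_right_diff_distrib algebra_simps)
  have "0 \<le> (1 - (cmod a)\<^sup>2) * ((norm w)\<^sup>2 - (norm (R w))\<^sup>2)"
    using a2 R(2)[of w] by (intro mult_nonneg_nonneg) (auto intro: power_mono)
  also have "\<dots> = (norm (v - t *\<^sub>C e))\<^sup>2 - (norm (R y - cnj a *\<^sub>C y))\<^sup>2"
    using moebius_norm_identity[of w a "R w"] by (simp add: 1 2)
  also have "(norm (v - t *\<^sub>C e))\<^sup>2 = (norm v)\<^sup>2 - (cmod t)\<^sup>2"
    unfolding t_def by (rule norm_diff_proj_unit[OF e(1)])
  finally have "(cmod t)\<^sup>2 \<le> (norm v)\<^sup>2 - (norm (R y - cnj a *\<^sub>C y))\<^sup>2" by simp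
  also have "\<dots> = (1 - (cmod a)\<^sup>2) * ((norm y)\<^sup>2 - (norm (R y))\<^sup>2)"
    using moebius_norm_identity[of y a "R y"] by (simp add: v_def)
  finally show ?thesis by (simp add: t_def v_def algebra_simps)
qed

text \<open>
  No word except the empty one leads from a basis vector to the vacuum.
\<close>

lemma adj_free_eval_creation_vacuum:
  fixes a :: "'n::countable list \<Rightarrow> complex"
  assumes conv: "free_convergent a (\<lambda>i. r *\<^sub>R creation i)"
  shows "adj (free_eval a (\<lambda>i. r *\<^sub>R creation i)) (ket []) = cnj (a []) *\<^sub>C ket []"
proof (rule ell2_eqI)
  fix \<alpha> :: "'n list"
  let ?T = "free_eval a (\<lambda>i. r *\<^sub>R creation i)"
  have T_bo: "?T \<in> bounded_ops"
    by (intro free_eval_bounded_ops conv bounded_ops_scaleR creation_bounded_ops)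
  have "coord (adj ?T (ket [])) \<alpha> = cinner (ket []) (?T (ket \<alpha>))"
    by (simp add: cinner_ket[symmetric] cinner_adj'[OF T_bo])
  also have "\<dots> = cnj (coord (?T (ket \<alpha>)) [])"
    by (metis cinner_commute cinner_ket)
  also have "coord (?T (ket \<alpha>)) [] = (if \<alpha> = [] then a [] else 0)"
  proof (cases "\<alpha> = []")
    case True
    then show ?thesis using coord_free_eval_creation[OF conv, of "[]"] by simp
  next
    case False
    let ?\<Phi> = "\<lambda>A :: 'n fock \<Rightarrow>\<^sub>L 'n fock. cinner (A (ket \<alpha>)) (ket [])"
    have "?\<Phi> ?T = (\<lambda>A :: 'n fock \<Rightarrow>\<^sub>L 'n fock. 0) ?T"
    proof (rule free_eval_eqI[OF conv _ conv])
      show "bounded_linear ?\<Phi>"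
        by (intro bounded_linear_compose[OF bounded_linear_cinner_left] blinfun.bounded_linear_left)
    qed (use False in \<open>simp_all add: word_op_scaleR word_op_creation_ket cinner_ket
        blinfun.bilinear_simps coord_ket\<close>)
    then show ?thesis using False by (simp add: cinner_ket)
  qed
  finally show "coord (adj ?T (ket [])) \<alpha> = coord (cnj (a []) *\<^sub>C ket []) \<alpha>"
    by (simp add: coord_ket)
qed

text \<open>
  Used with \<open>r < 1\<close>: then \<open>g(X) = g(rY)\<close> can be compared with \<open>g(rS)\<close>.
\<close>

lemma row_ball_dilate:
  fixes X :: "'n::countable \<Rightarrow> 'h::chilbert_space \<Rightarrow>\<^sub>L 'h"
  assumes "X \<in> row_ball" "row_norm X < r"
  obtains Y where "Y \<in> row_ball" "X = (\<lambda>i. r *\<^sub>R Y i)"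
proof (rule that)
  show "(\<lambda>i. (1 / r) *\<^sub>R X i) \<in> row_ball"
    using assms by (intro row_ball_scaleR) (simp_all add: row_ball_def)
  have "0 \<le> row_norm X" by (simp add: row_norm_def)
  then show "X = (\<lambda>i. r *\<^sub>R (1 / r) *\<^sub>R X i)"
    using assms(2) by simp
qed

lemma von_neumann_inequality:
  fixes X :: "'n::countable \<Rightarrow> 'h::chilbert_space \<Rightarrow>\<^sub>L 'h"
  assumes X: "X \<in> row_ball" "row_norm X < r" and convX: "free_convergent a X"
    and convS: "free_convergent a (\<lambda>i. r *\<^sub>R creation i)"
    and K: "norm (free_eval a (\<lambda>i. r *\<^sub>R creation i)) \<le> K"
  shows "norm (free_eval a X) \<le> K"
proof -
  obtain Y where Y: "Y \<in> row_ball" "X = (\<lambda>i. r *\<^sub>R Y i)"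
    using row_ball_dilate[OF X] .
  let ?T = "free_eval a (\<lambda>i. r *\<^sub>R creation i)"
  have "0 \<le> K" using K norm_ge_zero order_trans by blast
  have T_bo: "?T \<in> bounded_ops"
    by (intro free_eval_bounded_ops convS bounded_ops_scaleR creation_bounded_ops)
  have "free_eval a X \<in> bounded_ops"
    by (intro free_eval_bounded_ops convX row_ball_bounded_ops X)
  then show ?thesis
  proof (rule norm_le_if_adj_le[OF _ \<open>0 \<le> K\<close>])
    fix x
    have "(norm (adj ?T y))\<^sup>2 \<le> K\<^sup>2 * (norm y)\<^sup>2" for y
    proof -
      have "norm (adj ?T y) \<le> norm ?T * norm y" by (rule norm_adj_le[OF T_bo])
      also have "\<dots> \<le> K * norm y" by (intro mult_right_mono K) simp
      finally show ?thesis by (metis norm_ge_zero power_mono power_mult_distrib)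
    qed
    then have "0 * Re (defect_form Y (x - 0 *\<^sub>C adj (free_eval a X) x) (x - 0 *\<^sub>C adj (free_eval a X) x))
        + (norm (adj (free_eval a X) x))\<^sup>2 \<le> K\<^sup>2 * (norm x)\<^sup>2"
      using convX convS unfolding Y(2) by (intro poisson_transfer Y(1)) simp_all
    then have "(norm (adj (free_eval a X) x))\<^sup>2 \<le> (K * norm x)\<^sup>2"
      by (simp add: power_mult_distrib)
    then show "norm (adj (free_eval a X) x) \<le> K * norm x"
      by (rule power2_le_imp_le) (simp add: \<open>0 \<le> K\<close>)
  qed
qed

text \<open>
  With \<open>a = g(0)\<close>, transferring the inequality for \<open>T\<^sup>*\<close> and the vacuum gives
  \<open>\<parallel>x\<parallel>\<^sup>2 - \<parallel>G\<^sup>* x\<parallel>\<^sup>2 \<ge> \<langle>\<Delta>v, v\<rangle> / (1 - |a|\<^sup>2)\<close> for \<open>v = x - a G\<^sup>* x\<close>. The right side is at least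
  \<open>(1 - q) (1 - |a|)\<^sup>2 \<parallel>x\<parallel>\<^sup>2\<close>, where \<open>q < 1\<close> is the norm of \<open>\<Sum>\<^sub>i Y\<^sub>i Y\<^sub>i\<^sup>*\<close>, since \<open>\<parallel>G\<^sup>* x\<parallel> \<le> \<parallel>x\<parallel>\<close>.
\<close>

lemma strict_contraction:
  fixes X :: "'n::countable \<Rightarrow> 'h::chilbert_space \<Rightarrow>\<^sub>L 'h"
  assumes X: "X \<in> row_ball" "row_norm X < r" and convX: "free_convergent a X"
    and convS: "free_convergent a (\<lambda>i. r *\<^sub>R creation i)"
    and T: "norm (free_eval a (\<lambda>i. r *\<^sub>R creation i)) \<le> 1"
    and a: "cmod (a []) < 1"
  obtains k where "0 \<le> k" "k < 1" "\<And>x. norm (adj (free_eval a X) x) \<le> k * norm x"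
proof -
  obtain Y where Y: "Y \<in> row_ball" "X = (\<lambda>i. r *\<^sub>R Y i)"
    using row_ball_dilate[OF X] .
  let ?T = "free_eval a (\<lambda>i. r *\<^sub>R creation i)"
  let ?G = "free_eval a X"
  define q where "q = norm (row_square Y)"
  have q: "0 \<le> q" "q < 1"
    using row_ball_norm_less[OF Y(1)] by (simp_all add: q_def)
  have T_bo: "?T \<in> bounded_ops"
    by (intro free_eval_bounded_ops convS bounded_ops_scaleR creation_bounded_ops)
  have G_bo: "?G \<in> bounded_ops"
    by (intro free_eval_bounded_ops convX row_ball_bounded_ops X)
  have T_contr: "norm (adj ?T y) \<le> norm y" for y
    using norm_adj_le[OF T_bo, of y] mult_right_mono[OF T, of "norm y"] by simp
  have "norm ?G \<le> 1"
    by (rule von_neumann_inequality[OF X convX convS T])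
  then have G_contr: "norm (adj ?G x) \<le> norm x" for x
    using norm_adj_le[OF G_bo, of x] mult_right_mono[of "norm ?G" 1 "norm x"] by simp
  have a2: "0 < 1 - (cmod (a []))\<^sup>2"
    using a by (simp add: power_less_one_iff abs_square_less_1)
  define c where "c = 1 / (1 - (cmod (a []))\<^sup>2)"
  have "c \<ge> 1" using a2 by (simp add: c_def field_simps)
  have ineq: "c * (cmod (coord (y - a [] *\<^sub>C adj ?T y) []))\<^sup>2 + (norm (adj ?T y))\<^sup>2 \<le> 1 * (norm y)\<^sup>2" for y
  proof -
    have "(cmod (coord (y - a [] *\<^sub>C adj ?T y) []))\<^sup>2 + (1 - (cmod (a []))\<^sup>2) * (norm (adj ?T y))\<^sup>2
        \<le> (1 - (cmod (a []))\<^sup>2) * (norm y)\<^sup>2"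
      unfolding cinner_ket[symmetric]
      by (rule contraction_eigenvector[OF adj_bounded_ops[OF T_bo] T_contr norm_ket
            adj_free_eval_creation_vacuum[OF convS] a])
    then have "c * ((cmod (coord (y - a [] *\<^sub>C adj ?T y) []))\<^sup>2
          + (1 - (cmod (a []))\<^sup>2) * (norm (adj ?T y))\<^sup>2)
        \<le> c * ((1 - (cmod (a []))\<^sup>2) * (norm y)\<^sup>2)"
      using \<open>c \<ge> 1\<close> by (intro mult_left_mono) auto
    moreover have "c * (1 - (cmod (a []))\<^sup>2) = 1" using a2 by (simp add: c_def)
    ultimately show ?thesis
      by (simp only: distrib_left mult.assoc[symmetric])
  qed
  define \<delta> where "\<delta> = (1 - q) * (1 - cmod (a []))\<^sup>2"
  have \<delta>: "0 < \<delta>" "\<delta> \<le> 1"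
  proof -
    show "0 < \<delta>" using q a by (simp add: \<delta>_def)
    have "\<delta> \<le> 1 * 1"
      unfolding \<delta>_def using q a by (intro mult_mono) (auto simp: power_le_one_iff)
    then show "\<delta> \<le> 1" by simp
  qed
  have bound: "(norm (adj ?G x))\<^sup>2 \<le> (1 - \<delta>) * (norm x)\<^sup>2" for x
  proof -
    define v where "v = x - a [] *\<^sub>C adj ?G x"
    have "c * Re (defect_form Y v v) + (norm (adj ?G x))\<^sup>2 \<le> 1 * (norm x)\<^sup>2"
      using convX convS ineq unfolding v_def Y(2) by (intro poisson_transfer Y(1)) simp_all
    moreover have "\<delta> * (norm x)\<^sup>2 \<le> c * Re (defect_form Y v v)"
    proof -
      have "(1 - cmod (a [])) * norm x \<le> norm x - cmod (a []) * norm (adj ?G x)"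
        using mult_left_mono[OF G_contr[of x], of "cmod (a [])"] by (simp add: algebra_simps)
      also have "\<dots> \<le> norm v"
        using norm_triangle_ineq2[of x "a [] *\<^sub>C adj ?G x"] by (simp add: v_def norm_scaleC)
      finally have "((1 - cmod (a [])) * norm x)\<^sup>2 \<le> (norm v)\<^sup>2"
        using a by (intro power_mono) auto
      then have "\<delta> * (norm x)\<^sup>2 \<le> (1 - q) * (norm v)\<^sup>2"
        using q by (simp add: \<delta>_def power_mult_distrib mult.assoc mult_left_mono)
      also have "\<dots> \<le> Re (defect_form Y v v)"
        unfolding q_def by (rule defect_form_lower[OF Y(1)])
      also have "\<dots> \<le> c * Re (defect_form Y v v)"
      proof -
        have "0 \<le> Re (defect_form Y v v)"
          by (rule positive_form.nonneg[OF positive_form_defect[OF Y(1)]])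
        then show ?thesis using mult_right_mono[OF \<open>c \<ge> 1\<close>] by fastforce
      qed
      finally show ?thesis .
    qed
    ultimately show ?thesis by (simp add: algebra_simps)
  qed
  show ?thesis
  proof (rule that[of "sqrt (1 - \<delta>)"])
    show "norm (adj ?G x) \<le> sqrt (1 - \<delta>) * norm x" for x
    proof (rule power2_le_imp_le)
      show "(norm (adj ?G x))\<^sup>2 \<le> (sqrt (1 - \<delta>) * norm x)\<^sup>2"
        using bound[of x] \<delta> by (simp add: power_mult_distrib)
    qed (use \<delta> in simp)
  qed (use \<delta> in auto)
qed

text \<open>
  The vector \<open>f(rS) 1\<close> has norm at most \<open>1\<close> and vacuum coordinate of modulus \<open>1\<close>, so all its other
  coordinates vanish.
\<close>

lemma coeff_eq_0:
  assumes convS: "free_convergent a (\<lambda>i. r *\<^sub>R creation i)"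
    and T: "norm (free_eval a (\<lambda>i. r *\<^sub>R creation i)) \<le> 1"
    and "r > 0" "cmod (a []) = 1" "\<alpha> \<noteq> []"
  shows "a \<alpha> = 0"
proof -
  let ?y = "free_eval a (\<lambda>i. r *\<^sub>R creation i) (ket [])"
  have "norm ?y \<le> 1"
    using norm_blinfun[of "free_eval a (\<lambda>i. r *\<^sub>R creation i)" "ket []"] T by (simp add: norm_ket)
  then have "(norm ?y)\<^sup>2 \<le> 1" by (simp add: power_le_one_iff)
  moreover have "(\<Sum>\<beta>\<in>{[], \<alpha>}. (cmod (coord ?y \<beta>))\<^sup>2) \<le> (norm ?y)\<^sup>2"
    by (rule ell2_finite_sum_le) simp
  ultimately have "(\<Sum>\<beta>\<in>{[], \<alpha>}. (cmod (coord ?y \<beta>))\<^sup>2) \<le> 1" by linarith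
  then have "(cmod (a \<alpha> * complex_of_real (r ^ length \<alpha>)))\<^sup>2 \<le> 0"
    using assms(4,5) by (simp add: coord_free_eval_creation[OF convS] del: power_mult_distrib)
  then show ?thesis using \<open>r > 0\<close> by simp
qed

lemma free_eval_constant:
  assumes "\<And>\<alpha>. \<alpha> \<noteq> [] \<Longrightarrow> a \<alpha> = 0"
  shows "free_eval a X = scalar_op (a [])"
proof -
  have z: "scalar_op (a \<alpha>) o\<^sub>L word_op X \<alpha> = 0" if "\<alpha> \<noteq> []" for \<alpha>
    by (rule blinfun_eqI) (simp add: assms[OF that])
  have "homogeneous_part a X k = (if k = 0 then scalar_op (a []) else 0)" for k
  proof (cases "k = 0")
    case True
    then have "homogeneous_part a X k = scalar_op (a []) o\<^sub>L id_blinfun"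
      by (simp add: homogeneous_part_def)
    also have "\<dots> = scalar_op (a [])" by (rule blinfun_eqI) simp
    finally show ?thesis using True by simp
  next
    case False
    then show ?thesis
      unfolding homogeneous_part_def by (auto intro!: infsum_0 z)
  qed
  then have "homogeneous_part a X = (\<lambda>k. if k = 0 then scalar_op (a []) else 0)" by (rule ext)
  moreover have "(\<lambda>k. if k = 0 then scalar_op (a []) else 0) sums scalar_op (a [])"
    by (rule sums_single)
  ultimately show ?thesis
    unfolding free_eval_def by (metis sums_unique)
qed

section \<open>Factorization\<close>

lemma norm_radial_eval_le:
  fixes f :: "('n::countable \<Rightarrow> 'h \<Rightarrow>\<^sub>L 'h) \<Rightarrow> ('h::chilbert_space \<Rightarrow>\<^sub>L 'h)"
  assumes inf: "\<not> (\<exists>B :: 'h set. finite B \<and> complex_vector.span B = UNIV)"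
    and f: "free_holomorphic a f" and bound: "\<forall>X\<in>row_ball. norm (f X) \<le> K"
    and r: "0 \<le> r" "r < 1"
  shows "free_convergent a (\<lambda>i. r *\<^sub>R creation i)"
    and "norm (free_eval a (\<lambda>i. r *\<^sub>R creation i)) \<le> K"
proof -
  obtain X :: "'n \<Rightarrow> 'h \<Rightarrow>\<^sub>L 'h" and V :: "'n fock \<Rightarrow>\<^sub>L 'h" and W :: "'h \<Rightarrow>\<^sub>L 'n fock"
    where X: "X \<in> row_ball"
    and XV: "\<And>\<alpha> y. word_op X \<alpha> (V y) = V (word_op (\<lambda>i. r *\<^sub>R creation i) \<alpha> y)"
    and WV: "\<And>y. W (V y) = y" and Wc: "\<And>c h. W (c *\<^sub>C h) = c *\<^sub>C W h"
    and Vc: "\<And>c y. V (c *\<^sub>C y) = c *\<^sub>C V y"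
    and nW: "\<And>h. norm (W h) \<le> norm h" and nV: "\<And>y. norm (V y) = norm y"
    by (rule fock_copy[OF inf r]) (rule that)
  note eval = eval_fock_copy[OF f X XV WV Wc Vc]
  show "free_convergent a (\<lambda>i. r *\<^sub>R creation i)" by (rule eval(1))
  have "0 \<le> K" using order_trans[OF norm_ge_zero bspec[OF bound X]] .
  then show "norm (free_eval a (\<lambda>i. r *\<^sub>R creation i)) \<le> K"
  proof (rule norm_blinfun_bound)
    fix y
    have "norm (free_eval a (\<lambda>i. r *\<^sub>R creation i) y) \<le> norm (f X (V y))"
      unfolding eval(3) by (rule nW)
    also have "\<dots> \<le> norm (f X) * norm (V y)" by (rule norm_blinfun)
    also have "\<dots> \<le> K * norm y" unfolding nV by (intro mult_right_mono bspec[OF bound X]) simp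
    finally show "norm (free_eval a (\<lambda>i. r *\<^sub>R creation i) y) \<le> K * norm y" .
  qed
qed

lemma radial_eval_product:
  fixes f \<theta> g :: "('n::countable \<Rightarrow> 'h \<Rightarrow>\<^sub>L 'h) \<Rightarrow> ('h::chilbert_space \<Rightarrow>\<^sub>L 'h)"
  assumes inf: "\<not> (\<exists>B :: 'h set. finite B \<and> complex_vector.span B = UNIV)"
    and f: "free_holomorphic a f" and \<theta>: "free_holomorphic b \<theta>" and g: "free_holomorphic c g"
    and fac: "\<forall>X\<in>row_ball. f X = \<theta> X o\<^sub>L g X"
    and r: "0 \<le> r" "r < 1"
  shows "free_convergent c (\<lambda>i. r *\<^sub>R creation i)"
    and "free_eval a (\<lambda>i. r *\<^sub>R creation i) y
      = free_eval b (\<lambda>i. r *\<^sub>R creation i) (free_eval c (\<lambda>i. r *\<^sub>R creation i) y)"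
proof -
  obtain X :: "'n \<Rightarrow> 'h \<Rightarrow>\<^sub>L 'h" and V :: "'n fock \<Rightarrow>\<^sub>L 'h" and W :: "'h \<Rightarrow>\<^sub>L 'n fock"
    where X: "X \<in> row_ball"
    and XV: "\<And>\<alpha> y. word_op X \<alpha> (V y) = V (word_op (\<lambda>i. r *\<^sub>R creation i) \<alpha> y)"
    and WV: "\<And>y. W (V y) = y" and Wc: "\<And>c h. W (c *\<^sub>C h) = c *\<^sub>C W h"
    and Vc: "\<And>c y. V (c *\<^sub>C y) = c *\<^sub>C V y"
    by (rule fock_copy[OF inf r]) (rule that)
  show "free_convergent c (\<lambda>i. r *\<^sub>R creation i)"
    by (rule eval_fock_copy(1)[OF g X XV WV Wc Vc])
  show "free_eval a (\<lambda>i. r *\<^sub>R creation i) y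
      = free_eval b (\<lambda>i. r *\<^sub>R creation i) (free_eval c (\<lambda>i. r *\<^sub>R creation i) y)"
    unfolding eval_fock_copy(3)[OF f X XV WV Wc Vc] eval_fock_copy(3)[OF \<theta> X XV WV Wc Vc]
    by (simp add: bspec[OF fac X] eval_fock_copy(2)[OF g X XV WV Wc Vc])
qed

lemma norm_le_sup_norm:
  assumes "sup_norm f \<le> ereal K" "X \<in> row_ball"
  shows "norm (f X) \<le> K"
proof -
  have "ereal (norm (f X)) \<le> sup_norm f"
    unfolding sup_norm_def by (rule SUP_upper[OF assms(2)])
  then have "ereal (norm (f X)) \<le> ereal K" using assms(1) by (rule order_trans)
  then show ?thesis by simp
qed

lemma radial_infimum_lower:
  fixes \<theta> :: "('n::countable \<Rightarrow> 'h \<Rightarrow>\<^sub>L 'h) \<Rightarrow> ('h::chilbert_space \<Rightarrow>\<^sub>L 'h)"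
  assumes "radial_infimum_property a \<theta>" "sup_norm \<theta> = 1" "K > 1" "s < 1"
  obtains r where "s < r" "r < 1" "\<And>y. norm y \<le> K * norm (free_eval a (\<lambda>i. r *\<^sub>R creation i) y)"
proof -
  let ?m = "\<lambda>r. INF x\<in>{x :: 'n fock. norm x = 1}. ereal (norm (free_eval a (\<lambda>i. r *\<^sub>R creation i) x))"
  have "ereal (1 / K) < Liminf (at_left 1) ?m"
    using assms by (simp add: radial_infimum_property_def)
  then have "eventually (\<lambda>r. ereal (1 / K) < ?m r) (at_left 1)"
    by (rule less_LiminfD)
  moreover have "eventually (\<lambda>r. r \<in> {s<..<1}) (at_left 1)"
    by (rule eventually_at_left_real[OF assms(4)])
  ultimately have "eventually (\<lambda>r. ereal (1 / K) < ?m r \<and> r \<in> {s<..<1}) (at_left 1)"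
    by (rule eventually_conj)
  then obtain r where m: "ereal (1 / K) < ?m r" and r: "s < r" "r < 1"
    using eventually_happens'[OF trivial_limit_at_left_real] by fastforce
  show ?thesis
  proof (rule that[OF r])
    fix y :: "'n fock"
    let ?T = "free_eval a (\<lambda>i. r *\<^sub>R creation i)"
    show "norm y \<le> K * norm (?T y)"
    proof (cases "y = 0")
      case False
      then have "norm ((1 / norm y) *\<^sub>R y) = 1" by simp
      then have "?m r \<le> ereal (norm (?T ((1 / norm y) *\<^sub>R y)))"
        by (intro INF_lower) simp
      with m have "1 / K < norm (?T ((1 / norm y) *\<^sub>R y))"
        using less_le_trans less_ereal.simps(1) by blast
      also have "\<dots> = norm (?T y) / norm y"
        by (simp add: blinfun.scaleR_right)
      finally show ?thesis
        using False \<open>K > 1\<close> by (simp add: field_simps)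
    qed simp
  qed
qed

lemma cinner_mult_adj:
  assumes "A \<in> bounded_ops"
  shows "cinner ((A o\<^sub>L adj A) x) x = complex_of_real ((norm (adj A x))\<^sup>2)"
  by (simp only: blinfun_apply_blinfun_compose cinner_adj[OF assms] cinner_self)

lemma cinner_factor_difference:
  fixes A B :: "'h::chilbert_space \<Rightarrow>\<^sub>L 'h"
  assumes A: "A \<in> bounded_ops" and B: "B \<in> bounded_ops"
  shows "cinner (((A o\<^sub>L adj A) - ((A o\<^sub>L B) o\<^sub>L adj (A o\<^sub>L B))) x) x
    = complex_of_real ((norm (adj A x))\<^sup>2 - (norm (adj B (adj A x)))\<^sup>2)"
  using cinner_mult_adj[OF A, of x] cinner_mult_adj[OF bounded_ops_compose[OF A B], of x]
  by (simp add: blinfun.diff_left cinner_diff_left adj_compose[OF A B])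

text \<open>
  \<open>A A\<^sup>* - (A B) (A B)\<^sup>* = A (1 - B B\<^sup>*) A\<^sup>*\<close>.
\<close>

lemma op_le_factor:
  fixes A B :: "'h::chilbert_space \<Rightarrow>\<^sub>L 'h"
  assumes A: "A \<in> bounded_ops" and B: "B \<in> bounded_ops" and "norm B \<le> 1"
  shows "op_le ((A o\<^sub>L B) o\<^sub>L adj (A o\<^sub>L B)) (A o\<^sub>L adj A)"
proof -
  have "norm (adj B y) \<le> norm y" for y
    using norm_adj_le[OF B, of y] mult_right_mono[OF \<open>norm B \<le> 1\<close>, of "norm y"] by simp
  then have "(norm (adj B y))\<^sup>2 \<le> (norm y)\<^sup>2" for y
    by (simp add: power_mono)
  then show ?thesis
    unfolding op_le_def positive_op_def cinner_factor_difference[OF A B]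
    using A B by (simp add: bounded_ops_diff bounded_ops_compose adj_bounded_ops
        complex_nonneg_Reals_iff)
qed

text \<open>
  The difference is \<open>A (1 - B B\<^sup>*) A\<^sup>*\<close>, squeezed between a positive multiple of \<open>A A\<^sup>*\<close> and
  \<open>A A\<^sup>*\<close> itself.
\<close>

lemma op_less_factor_iff:
  fixes A B :: "'h::chilbert_space \<Rightarrow>\<^sub>L 'h"
  assumes A: "A \<in> bounded_ops" and B: "B \<in> bounded_ops"
    and k: "0 \<le> k" "k < 1" "\<And>y. norm (adj B y) \<le> k * norm y"
  shows "op_less ((A o\<^sub>L B) o\<^sub>L adj (A o\<^sub>L B)) (A o\<^sub>L adj A) \<longleftrightarrow> op_less 0 (A o\<^sub>L adj A)"
proof -
  let ?P = "A o\<^sub>L adj A"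
  let ?D = "(A o\<^sub>L adj A) - ((A o\<^sub>L B) o\<^sub>L adj (A o\<^sub>L B))"
  have P_bo: "?P \<in> bounded_ops" and D_bo: "?D \<in> bounded_ops"
    using A B by (simp_all add: bounded_ops_diff bounded_ops_compose adj_bounded_ops)
  have P: "inner (?P x) x = (norm (adj A x))\<^sup>2" for x
    unfolding Re_cinner[symmetric] cinner_mult_adj[OF A] by simp
  have D: "inner (?D x) x = (norm (adj A x))\<^sup>2 - (norm (adj B (adj A x)))\<^sup>2" for x
    unfolding Re_cinner[symmetric] cinner_factor_difference[OF A B] by simp
  have P_pos: "positive_op ?P"
    unfolding positive_op_def cinner_mult_adj[OF A] using P_bo by simp
  have "norm B \<le> 1"
    by (rule order_trans[OF norm_le_if_adj_le[OF B k(1,3)]]) (use k in auto)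
  then have D_pos: "positive_op ?D"
    using op_le_factor[OF A B] by (simp add: op_le_def)
  have k2: "k\<^sup>2 < 1" using k by (simp add: power_less_one_iff abs_square_less_1)
  have D_lower: "(1 - k\<^sup>2) * inner (?P x) x \<le> inner (?D x) x" for x
    using power_mono[OF k(3)[of "adj A x"] norm_ge_zero, of 2]
    unfolding P D by (simp add: power_mult_distrib algebra_simps)
  show ?thesis
  proof
    assume "op_less ((A o\<^sub>L B) o\<^sub>L adj (A o\<^sub>L B)) ?P"
    then obtain c where "c > 0" "\<And>x. c * (norm x)\<^sup>2 \<le> inner (?D x) x"
      using positive_invertible_bounded_below[of ?D] by (auto simp: op_less_def)
    moreover have "inner (?D x) x \<le> inner (?P x) x" for x
      unfolding P D by simp
    ultimately have "invertible_op ?P"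
      by (intro bounded_below_invertible[OF P_bo]) (auto intro: order_trans)
    then show "op_less 0 ?P"
      using P_pos by (simp add: op_less_def)
  next
    assume "op_less 0 ?P"
    then obtain c where c: "c > 0" "\<And>x. c * (norm x)\<^sup>2 \<le> inner (?P x) x"
      using positive_invertible_bounded_below[of ?P] by (auto simp: op_less_def)
    have "(1 - k\<^sup>2) * c * (norm x)\<^sup>2 \<le> inner (?D x) x" for x
    proof -
      have "(1 - k\<^sup>2) * (c * (norm x)\<^sup>2) \<le> (1 - k\<^sup>2) * inner (?P x) x"
        using k2 by (intro mult_left_mono c) simp
      then show ?thesis using D_lower[of x] by (simp add: mult.assoc)
    qed
    then have "invertible_op ?D"
      using k2 c(1) by (intro bounded_below_invertible[OF D_bo, of "(1 - k\<^sup>2) * c"]) auto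
    then show "op_less ((A o\<^sub>L B) o\<^sub>L adj (A o\<^sub>L B)) ?P"
      using D_pos by (simp add: op_less_def)
  qed
qed

theorem theorem4p5:
  fixes f \<theta> g :: "('n::countable \<Rightarrow> 'h \<Rightarrow>\<^sub>L 'h) \<Rightarrow> ('h::chilbert_space \<Rightarrow>\<^sub>L 'h)"
    and f_coeff \<theta>_coeff g_coeff :: "'n list \<Rightarrow> complex"
  assumes separable: "separable_space (euclidean :: 'h topology)"
    and infinite_dim: "\<not> (\<exists>B :: 'h set. finite B \<and> complex_vector.span B = UNIV)"
    and f: "free_holomorphic f_coeff f"
    and \<theta>: "free_holomorphic \<theta>_coeff \<theta>"
    and g: "free_holomorphic g_coeff g"
    and i: "\<forall>X\<in>row_ball. f X = \<theta> X o\<^sub>L g X"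
    and ii: "sup_norm f \<le> 1"
    and iii: "radial_infimum_property \<theta>_coeff \<theta>" "sup_norm \<theta> = 1"
  shows "sup_norm g \<le> 1 \<and>
    (\<forall>X\<in>row_ball. op_le (f X o\<^sub>L adj (f X)) (\<theta> X o\<^sub>L adj (\<theta> X))) \<and>
    (\<forall>X\<in>row_ball. norm (f X) \<le> norm (\<theta> X)) \<and>
    cmod (g_coeff []) \<le> 1 \<and>
    (\<forall>X\<^sub>0\<in>row_ball.
       op_less (f X\<^sub>0 o\<^sub>L adj (f X\<^sub>0)) (\<theta> X\<^sub>0 o\<^sub>L adj (\<theta> X\<^sub>0)) \<longleftrightarrow>
       op_less 0 (\<theta> X\<^sub>0 o\<^sub>L adj (\<theta> X\<^sub>0)) \<and>
       \<not> (\<exists>c. cmod c = 1 \<and> (\<forall>X\<in>row_ball. g X = scalar_op c))) \<and>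
    (\<forall>X\<^sub>0\<in>row_ball.
       norm (f X\<^sub>0) = norm (\<theta> X\<^sub>0) \<longleftrightarrow>
       \<theta> X\<^sub>0 = 0 \<or> (\<exists>c. cmod c = 1 \<and> (\<forall>X\<in>row_ball. f X = scalar_op c o\<^sub>L \<theta> X))) \<and>
    (cmod (g_coeff []) = 1 \<longrightarrow>
       (\<exists>c. cmod c = 1 \<and> (\<forall>X\<in>row_ball. f X = scalar_op c o\<^sub>L \<theta> X)))"
proof -
  have fac: "f X = \<theta> X o\<^sub>L g X" if "X \<in> row_ball" for X
    using i that by blast
  have f_le: "\<forall>X\<in>row_ball. norm (f X) \<le> 1"
    using norm_le_sup_norm[of f 1] ii by (simp add: one_ereal_def)
  have bo: "f' X \<in> bounded_ops" if "free_holomorphic a f'" "X \<in> row_ball"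
    for a and f' :: "('n \<Rightarrow> 'h \<Rightarrow>\<^sub>L 'h) \<Rightarrow> ('h \<Rightarrow>\<^sub>L 'h)" and X
    using free_holomorphicD[OF that] row_ball_bounded_ops[OF that(2)]
    by (simp add: free_eval_bounded_ops)
  have nontrivial: "\<exists>v :: 'h. v \<noteq> 0"
  proof (rule ccontr)
    assume "\<nexists>v :: 'h. v \<noteq> 0"
    then have "complex_vector.span {} = (UNIV :: 'h set)" by auto
    then show False using infinite_dim finite.emptyI by blast
  qed
  then obtain v\<^sub>0 :: 'h where v\<^sub>0: "v\<^sub>0 \<noteq> 0" by blast
  have g_le: "norm (g X) \<le> 1" if X: "X \<in> row_ball" for X
  proof (rule dense_ge)
    fix K :: real assume "1 < K"
    have "row_norm X < 1" and "0 \<le> row_norm X"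
      using X by (simp_all add: row_ball_def row_norm_def)
    obtain r where r: "row_norm X < r" "r < 1"
      and low: "\<And>y. norm y \<le> K * norm (free_eval \<theta>_coeff (\<lambda>i. r *\<^sub>R creation i) y)"
      by (rule radial_infimum_lower[OF iii \<open>1 < K\<close> \<open>row_norm X < 1\<close>]) (rule that)
    have "0 \<le> r" using r \<open>0 \<le> row_norm X\<close> by simp
    note prod = radial_eval_product[OF infinite_dim f \<theta> g i \<open>0 \<le> r\<close> r(2)]
    have f1: "norm (free_eval f_coeff (\<lambda>i. r *\<^sub>R creation i)) \<le> 1"
      by (rule norm_radial_eval_le(2)[OF infinite_dim f f_le \<open>0 \<le> r\<close> r(2)])
    have "norm (free_eval g_coeff (\<lambda>i. r *\<^sub>R creation i)) \<le> K"
    proof (rule norm_blinfun_bound)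
      fix y :: "'n fock"
      have "norm (free_eval g_coeff (\<lambda>i. r *\<^sub>R creation i) y)
          \<le> K * norm (free_eval f_coeff (\<lambda>i. r *\<^sub>R creation i) y)"
        unfolding prod(2) by (rule low)
      also have "norm (free_eval f_coeff (\<lambda>i. r *\<^sub>R creation i) y) \<le> 1 * norm y"
        by (rule order_trans[OF norm_blinfun mult_right_mono[OF f1 norm_ge_zero]])
      finally show "norm (free_eval g_coeff (\<lambda>i. r *\<^sub>R creation i) y) \<le> K * norm y"
        using \<open>1 < K\<close> by simp
    qed (use \<open>1 < K\<close> in simp)
    then have "norm (free_eval g_coeff X) \<le> K"
      by (rule von_neumann_inequality[OF X r(1) free_holomorphicD(1)[OF g X] prod(1)])
    then show "norm (g X) \<le> K" by (simp add: free_holomorphicD(2)[OF g X])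
  qed
  have T: "free_convergent g_coeff (\<lambda>i. r *\<^sub>R creation i)"
      "norm (free_eval g_coeff (\<lambda>i. r *\<^sub>R creation i)) \<le> 1" if "0 \<le> r" "r < 1" for r
    using norm_radial_eval_le[OF infinite_dim g _ that, of 1] g_le by simp_all
  define a where "a = g_coeff []"
  have a_le: "cmod a \<le> 1"
  proof -
    let ?T = "free_eval g_coeff (\<lambda>i. 0 *\<^sub>R creation i)"
    have "cmod (coord (?T (ket [])) []) \<le> norm (?T (ket []))"
      by (rule coord_le_norm)
    also have "\<dots> \<le> norm ?T * norm (ket [] :: 'n fock)"
      by (rule norm_blinfun)
    also have "\<dots> \<le> 1"
      using T(2)[of 0] by (simp add: norm_ket)
    finally have "cmod (coord (?T (ket [])) []) \<le> 1" .
    then show ?thesis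
      unfolding coord_free_eval_creation[OF T(1)[OF order_refl zero_less_one]] by (simp add: a_def)
  qed
  have g_const: "g X = scalar_op a" if "cmod a = 1" "X \<in> row_ball" for X
  proof -
    have "g_coeff \<alpha> = 0" if "\<alpha> \<noteq> []" for \<alpha>
      by (rule coeff_eq_0[of _ "1 / 2"]) (use T[of "1 / 2"] \<open>cmod a = 1\<close> that in \<open>simp_all add: a_def\<close>)
    then have "free_eval g_coeff X = scalar_op a"
      unfolding a_def by (rule free_eval_constant)
    then show ?thesis using free_holomorphicD(2)[OF g that(2)] by simp
  qed
  have f_const: "f X = scalar_op a o\<^sub>L \<theta> X" if "cmod a = 1" "X \<in> row_ball" for X
    unfolding fac[OF that(2)] g_const[OF that]
    by (rule blinfun_eqI) (simp add: bounded_opsD[OF bo[OF \<theta> that(2)]])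
  have g_strict: "\<exists>k. 0 \<le> k \<and> k < 1 \<and> (\<forall>x. norm (adj (g X) x) \<le> k * norm x)"
    if "cmod a < 1" and X: "X \<in> row_ball" for X
  proof -
    have "row_norm X < 1" and "0 \<le> row_norm X"
      using X by (simp_all add: row_ball_def row_norm_def)
    then obtain r where r: "row_norm X < r" "r < 1" using dense by blast
    have "0 \<le> r" using r \<open>0 \<le> row_norm X\<close> by simp
    obtain k where "0 \<le> k" "k < 1" "\<And>x. norm (adj (free_eval g_coeff X) x) \<le> k * norm x"
      using strict_contraction[OF X r(1) free_holomorphicD(1)[OF g X] T[OF \<open>0 \<le> r\<close> r(2)]]
        \<open>cmod a < 1\<close> unfolding a_def by blast
    then show ?thesis unfolding free_holomorphicD(2)[OF g X] by blast
  qed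
  have unimodular: "cmod a = 1" if "cmod c = 1" "\<forall>X\<in>row_ball. g X = scalar_op c" for c
  proof (rule ccontr)
    assume "cmod a \<noteq> 1"
    then have "cmod a < 1" using a_le by simp
    obtain X :: "'n \<Rightarrow> 'h \<Rightarrow>\<^sub>L 'h" where X: "X \<in> row_ball"
      by (rule fock_copy[OF infinite_dim order_refl zero_less_one])
    obtain k where k: "0 \<le> k" "k < 1" "\<And>x. norm (adj (g X) x) \<le> k * norm x"
      using g_strict[OF \<open>cmod a < 1\<close> X] by blast
    have "norm (g X) \<le> k" by (rule norm_le_if_adj_le[OF bo[OF g X] k(1,3)])
    moreover have "norm (g X) = 1" using that X norm_scalar_op[OF v\<^sub>0] by simp
    ultimately show False using k(2) by simp
  qed
  have f_norm: "norm (f X) \<le> norm (\<theta> X) * norm (g X)" if "X \<in> row_ball" for X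
    unfolding fac[OF that] by (rule norm_blinfun_compose)
  have f_theta: "norm (f X) \<le> norm (\<theta> X)" if "X \<in> row_ball" for X
    using f_norm[OF that] mult_left_mono[OF g_le[OF that], of "norm (\<theta> X)"] by simp
  show ?thesis
  proof (intro conjI ballI impI)
    show "sup_norm g \<le> 1"
      unfolding sup_norm_def by (rule SUP_least) (simp add: one_ereal_def g_le)
    show "cmod (g_coeff []) \<le> 1"
      using a_le by (simp add: a_def)
  next
    fix X assume X: "X \<in> (row_ball :: ('n \<Rightarrow> 'h \<Rightarrow>\<^sub>L 'h) set)"
    show "op_le (f X o\<^sub>L adj (f X)) (\<theta> X o\<^sub>L adj (\<theta> X))"
      unfolding fac[OF X] by (rule op_le_factor[OF bo[OF \<theta> X] bo[OF g X] g_le[OF X]])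
    show "norm (f X) \<le> norm (\<theta> X)" by (rule f_theta[OF X])
  next
    fix X assume X: "X \<in> (row_ball :: ('n \<Rightarrow> 'h \<Rightarrow>\<^sub>L 'h) set)"
    show "op_less (f X o\<^sub>L adj (f X)) (\<theta> X o\<^sub>L adj (\<theta> X)) \<longleftrightarrow>
       op_less 0 (\<theta> X o\<^sub>L adj (\<theta> X)) \<and>
       \<not> (\<exists>c. cmod c = 1 \<and> (\<forall>X\<in>row_ball. g X = scalar_op c))"
    proof (cases "cmod a = 1")
      case True
      have "f X o\<^sub>L adj (f X) = \<theta> X o\<^sub>L adj (\<theta> X)"
      proof (rule blinfun_eqI)
        fix x
        have "a * cnj a = 1"
          using True complex_norm_square[of a] by simp
        then show "(f X o\<^sub>L adj (f X)) x = (\<theta> X o\<^sub>L adj (\<theta> X)) x"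
          unfolding fac[OF X] g_const[OF True X]
          by (simp add: adj_compose[OF bo[OF \<theta> X] scalar_op_bounded_ops] adj_scalar_op scaleC_scaleC)
      qed
      moreover have "\<not> invertible_op (0 :: 'h \<Rightarrow>\<^sub>L 'h)"
      proof
        assume "invertible_op (0 :: 'h \<Rightarrow>\<^sub>L 'h)"
        then have "(id_blinfun :: 'h \<Rightarrow>\<^sub>L 'h) = 0" by (auto simp: invertible_op_def)
        then show False using v\<^sub>0 by (metis blinfun.zero_left blinfun_apply_id_blinfun)
      qed
      ultimately show ?thesis
        using g_const[OF True] True by (auto simp: op_less_def)
    next
      case False
      then have "cmod a < 1" using a_le by simp
      then obtain k where k: "0 \<le> k" "k < 1" "\<And>x. norm (adj (g X) x) \<le> k * norm x"
        using g_strict[OF _ X] by blast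
      have "\<not> (\<exists>c. cmod c = 1 \<and> (\<forall>X\<in>row_ball. g X = scalar_op c))"
        using unimodular False by blast
      then show ?thesis
        unfolding fac[OF X] using op_less_factor_iff[OF bo[OF \<theta> X] bo[OF g X] k] by blast
    qed
  next
    fix X assume X: "X \<in> (row_ball :: ('n \<Rightarrow> 'h \<Rightarrow>\<^sub>L 'h) set)"
    show "norm (f X) = norm (\<theta> X) \<longleftrightarrow>
       \<theta> X = 0 \<or> (\<exists>c. cmod c = 1 \<and> (\<forall>X\<in>row_ball. f X = scalar_op c o\<^sub>L \<theta> X))"
    proof
      assume eq: "norm (f X) = norm (\<theta> X)"
      show "\<theta> X = 0 \<or> (\<exists>c. cmod c = 1 \<and> (\<forall>X\<in>row_ball. f X = scalar_op c o\<^sub>L \<theta> X))"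
      proof (cases "cmod a = 1")
        case True
        then show ?thesis using f_const by blast
      next
        case False
        then have "cmod a < 1" using a_le by simp
        then obtain k where k: "0 \<le> k" "k < 1" "\<And>x. norm (adj (g X) x) \<le> k * norm x"
          using g_strict[OF _ X] by blast
        have "norm (g X) \<le> k" by (rule norm_le_if_adj_le[OF bo[OF g X] k(1,3)])
        then have "norm (\<theta> X) \<le> norm (\<theta> X) * k"
          using f_norm[OF X] mult_left_mono[of "norm (g X)" k "norm (\<theta> X)"] eq by simp
        then have "norm (\<theta> X) * (1 - k) \<le> 0" by (simp add: algebra_simps)
        then have "norm (\<theta> X) \<le> 0" using k(2) by (simp add: mult_le_0_iff)
        then show ?thesis by simp
      qed
    next
      assume "\<theta> X = 0 \<or> (\<exists>c. cmod c = 1 \<and> (\<forall>X\<in>row_ball. f X = scalar_op c o\<^sub>L \<theta> X))"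
      then show "norm (f X) = norm (\<theta> X)"
      proof
        assume "\<theta> X = 0"
        then show ?thesis using f_theta[OF X] by simp
      next
        assume "\<exists>c. cmod c = 1 \<and> (\<forall>X\<in>row_ball. f X = scalar_op c o\<^sub>L \<theta> X)"
        then obtain c where c: "cmod c = 1" "f X = scalar_op c o\<^sub>L \<theta> X" using X by blast
        have "norm (\<theta> X) \<le> norm (f X)"
        proof (rule norm_blinfun_bound)
          fix x
          have "norm (\<theta> X x) = norm (f X x)" by (simp add: c norm_scaleC)
          also have "\<dots> \<le> norm (f X) * norm x" by (rule norm_blinfun)
          finally show "norm (\<theta> X x) \<le> norm (f X) * norm x" .
        qed simp
        then show ?thesis using f_theta[OF X] by simp
      qed
    qed
  next
    assume "cmod (g_coeff []) = 1"
    then show "\<exists>c. cmod c = 1 \<and> (\<forall>X\<in>row_ball. f X = scalar_op c o\<^sub>L \<theta> X)"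
      using f_const by (intro exI[of _ a]) (simp add: a_def)
  qed
qed

end
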